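(* The following hold. (1) Let $n\neq 4$ be a positive integer and let $K=\mathbb{Q}(\sqrt{1-2^{n+2}})$. Then the prime $2$ splits in $\mathcal{O}_K$ into two distinct prime ideals, and the class of each of them in the ideal class group $\mathrm{Cl}(\mathcal{O}_K)$ has order $n$. (2) Let $K=\mathbb{Q}(\sqrt{-39})$. Then the prime $2$ splits in $\mathcal{O}_K$ into two distinct prime ideals whose classes in $\mathrm{Cl}(\mathcal{O}_K)$ have order $4$. (3) Let $\ell$ be an odd prime and $n$ a positive integer, and set $K_1=\mathbb{Q}(\sqrt{1-\ell^n})$ and $K_2=\mathbb{Q}(\sqrt{1-4\ell^n})$. Then for at least one $i\in\{1,2\}$, the prime $\ell$ splits in $\mathcal{O}_{K_i}$ into two distinct prime ideals whose classes in $\mathrm{Cl}(\mathcal{O}_{K_i})$ have order $n$.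
   Context: $\mathcal{O}_K$ denotes the ring of integers of the number field $K$ and $\mathrm{Cl}(\mathcal{O}_K)$ its ideal class group. *)

theory Defs
  imports Complex_Main "HOL-Computational_Algebra.Polynomial"
begin

definition quad_field :: "int \<Rightarrow> complex set" where
  "quad_field D = {of_rat a + of_rat b * csqrt (of_int D) | a b. True}"

definition alg_int :: "complex \<Rightarrow> bool" where
  "alg_int x \<longleftrightarrow> (\<exists>p :: int poly. lead_coeff p = 1 \<and> poly (map_poly of_int p) x = 0)"

definition ring_of_integers :: "int \<Rightarrow> complex set" where
  "ring_of_integers D = {x \<in> quad_field D. alg_int x}"

definition is_ideal :: "complex set \<Rightarrow> complex set \<Rightarrow> bool" where
  "is_ideal R I \<longleftrightarrow> I \<subseteq> R \<and> 0 \<in> I \<and> (\<forall>x\<in>I. \<forall>y\<in>I. x + y \<in> I)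
      \<and> (\<forall>r\<in>R. \<forall>x\<in>I. r * x \<in> I)"

definition ideal_gen :: "complex set \<Rightarrow> complex set \<Rightarrow> complex set" where
  "ideal_gen R S = \<Inter>{I. is_ideal R I \<and> S \<subseteq> I}"

definition ideal_mult :: "complex set \<Rightarrow> complex set \<Rightarrow> complex set \<Rightarrow> complex set" where
  "ideal_mult R I J = ideal_gen R {x * y | x y. x \<in> I \<and> y \<in> J}"

primrec ideal_pow :: "complex set \<Rightarrow> complex set \<Rightarrow> nat \<Rightarrow> complex set" where
  "ideal_pow R I 0 = R"
| "ideal_pow R I (Suc m) = ideal_mult R I (ideal_pow R I m)"

definition principal_ideal :: "complex set \<Rightarrow> complex \<Rightarrow> complex set" where
  "principal_ideal R a = {a * r | r. r \<in> R}"

definition is_principal :: "complex set \<Rightarrow> complex set \<Rightarrow> bool" where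
  "is_principal R I \<longleftrightarrow> (\<exists>a\<in>R. I = principal_ideal R a)"

definition prime_ideal :: "complex set \<Rightarrow> complex set \<Rightarrow> bool" where
  "prime_ideal R P \<longleftrightarrow> is_ideal R P \<and> P \<noteq> R \<and> P \<noteq> {0}
      \<and> (\<forall>x\<in>R. \<forall>y\<in>R. x * y \<in> P \<longrightarrow> x \<in> P \<or> y \<in> P)"

text \<open>The class of a nonzero integral ideal P has order n in Cl(R):
  n is the least positive exponent with P^n principal (the identity class).\<close>
definition has_class_order :: "complex set \<Rightarrow> complex set \<Rightarrow> nat \<Rightarrow> bool" where
  "has_class_order R P n \<longleftrightarrow> n > 0 \<and> is_principal R (ideal_pow R P n)
      \<and> (\<forall>m. 0 < m \<and> m < n \<longrightarrow> \<not> is_principal R (ideal_pow R P m))"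

definition splits_with_order :: "int \<Rightarrow> nat \<Rightarrow> nat \<Rightarrow> bool" where
  "splits_with_order D p n \<longleftrightarrow>
     (let R = ring_of_integers D in
       \<exists>P Q. prime_ideal R P \<and> prime_ideal R Q \<and> P \<noteq> Q
         \<and> ideal_mult R P Q = principal_ideal R (of_nat p)
         \<and> has_class_order R P n \<and> has_class_order R Q n)"

end

theory Submission
  imports Defs "HOL-Computational_Algebra.Computational_Algebra" "HOL-Number_Theory.Cong"
begin

text \<open>In each case there is an integer \<open>\<alpha>\<close> of the field with norm \<open>p ^ n\<close> and trace \<open>t\<close> prime to \<open>p\<close>,
  so the prime \<open>P = (p, \<alpha>)\<close> satisfies \<open>P ^ j = (p ^ j, \<alpha>)\<close> for \<open>j \<le> n\<close>, and \<open>P ^ n = (\<alpha>)\<close>.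
  If the order of \<open>P\<close> is less than \<open>n\<close>, then \<open>\<alpha>\<close> is a unit times \<open>\<gamma> ^ r\<close> for a prime \<open>r\<close> dividing \<open>n\<close>.
  Absorbing the unit, \<open>\<plusminus> t\<close> becomes the \<open>r\<close>-th term of the Lucas sequence with parameters the trace and
  the norm of \<open>\<gamma>\<close>; only the units of order 4 with \<open>r = 2\<close> and those of order 3 or 6 with \<open>r = 3\<close> escape.
  For \<open>t = 1\<close> and odd \<open>r\<close> this is impossible by congruences modulo powers of the norm. For \<open>t = 2\<close> it can
  happen (\<open>1 - 3 ^ 5 = - 2 * 11\<^sup>2\<close>), but a valuation argument excludes it once the failure of the
  claim for \<open>\<rat>(\<surd>(1 - 4 l ^ n))\<close> has forced \<open>n\<close> to be even or divisible by 3.\<close>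

subsection \<open>Integers of imaginary quadratic fields\<close>

lemma alg_int_iff: "alg_int x \<longleftrightarrow> algebraic_int x"
  unfolding alg_int_def algebraic_int_altdef_ipoly by auto

lemma quad_algebraic_int:
  fixes z :: complex
  assumes "z + cnj z = of_int a" "z * cnj z = of_int b"
  shows "algebraic_int z"
proof -
  have "poly (map_poly of_int [:b, -a, 1:]) z = of_int b - of_int a * z + z * z"
    by (simp add: map_poly_pCons algebra_simps)
  also have "\<dots> = 0" unfolding assms(1,2)[symmetric] by algebra
  finally show ?thesis unfolding algebraic_int_altdef_ipoly
    by (intro exI[of _ "[:b, -a, 1:]"]) auto
qed

lemma map_poly_of_int_mult:
  "(map_poly of_int (p * q) :: 'a :: field_char_0 poly) = map_poly of_int p * map_poly of_int q"
  by (intro poly_eqI) (simp add: coeff_map_poly coeff_mult)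

lemma map_poly_of_int_add:
  "(map_poly of_int (p + q) :: 'a :: field_char_0 poly) = map_poly of_int p + map_poly of_int q"
  by (intro poly_eqI) (simp add: coeff_map_poly)

lemma map_poly_of_int_smult:
  "(map_poly of_int (smult c q) :: 'a :: field_char_0 poly) = smult (of_int c) (map_poly of_int q)"
  by (intro poly_eqI) (simp add: coeff_map_poly)

text \<open>Meant for the remainder of a division by a quadratic: the imaginary part of
  \<open>a + z * b\<close> forces \<open>b = 0\<close>, and then the real part forces
  \<open>a = 0\<close>.\<close>

lemma linear_int_poly_root_nonreal:
  fixes z :: complex
  assumes "poly (map_poly of_int p) z = 0" "degree p < 2" "Im z \<noteq> 0"
  shows "p = 0"
proof -
  define a b where "a = coeff p 0" and "b = coeff p 1"
  have p: "p = [:a, b:]"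
    using assms(2) by (intro poly_eqI) (auto simp: a_def b_def coeff_pCons coeff_eq_0 split: nat.splits)
  have "of_int a + z * of_int b = 0" using assms(1) by (simp add: p map_poly_pCons)
  then have "Im (of_int a + z * of_int b) = 0" "Re (of_int a + z * of_int b) = 0" by simp_all
  then show ?thesis using assms(3) by (simp add: p)
qed

text \<open>Gauss's lemma: a primitive quadratic polynomial vanishing at \<open>z\<close> divides the monic
  polynomial of \<open>z\<close>, so its leading coefficient is a unit.\<close>
lemma algebraic_int_trace_norm:
  fixes z :: complex
  assumes alg: "algebraic_int z" and im: "Im z \<noteq> 0"
    and tr: "z + cnj z = of_rat a" and nm: "z * cnj z = of_rat b"
  shows "a \<in> \<int> \<and> b \<in> \<int>"
proof -
  obtain p where p: "poly (map_poly of_int p) z = 0" "lead_coeff p = 1"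
    using alg unfolding algebraic_int_altdef_ipoly by blast
  obtain a1 a2 where a: "a = of_int a1 / of_int a2" "a2 > 0"
    by (metis quotient_of_div quotient_of_denom_pos surj_pair)
  obtain b1 b2 where b: "b = of_int b1 / of_int b2" "b2 > 0"
    by (metis quotient_of_div quotient_of_denom_pos surj_pair)
  \<comment> \<open>\<open>h\<close> is the quadratic with roots \<open>z\<close> and
    \<open>cnj z\<close>, cleared of denominators by the factor \<open>a2 * b2\<close>.\<close>
  define h where "h = [:b1 * a2, - a1 * b2, a2 * b2:]"
  define g where "g = primitive_part h"
  have h0: "h \<noteq> 0" and dh: "degree h = 2" using a b by (auto simp: h_def)
  have hg: "h = smult (content h) g" by (simp add: g_def)
  have dg: "degree g = 2" using dh h0 by (simp add: g_def)
  have cg: "content g = 1" using h0 by (simp add: g_def)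
  have g0: "g \<noteq> 0" using dg by auto
  have ab: "(of_int a1 :: complex) = of_int a2 * of_rat a" "(of_int b1 :: complex) = of_int b2 * of_rat b"
    using a b by (simp_all add: of_rat_divide)
  have "poly (map_poly of_int h) z = of_int a2 * of_int b2 * (of_rat b - of_rat a * z + z * z)"
    using ab by (simp add: h_def map_poly_pCons algebra_simps)
  also have "\<dots> = 0" unfolding tr[symmetric] nm[symmetric] by algebra
  finally have "poly (map_poly of_int h) z = 0" .
  then have gz: "poly (map_poly of_int g) z = 0"
    using h0 by (subst (asm) hg) (simp add: map_poly_of_int_smult)
  \<comment> \<open>Over the integers only pseudo-division is available, at the price of the factor
    \<open>c\<close>. As \<open>g\<close> and \<open>p\<close> both have content 1, \<open>c\<close>
    is the content of \<open>s\<close> up to sign and can be cancelled.\<close>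
  obtain s r where sr: "pseudo_divmod p g = (s, r)" by (metis surj_pair)
  define c where "c = coeff g (degree g) ^ (Suc (degree p) - degree g)"
  have eq: "smult c p = g * s + r" and r: "r = 0 \<or> degree r < 2"
    using pseudo_divmod[OF g0 sr] dg by (auto simp: c_def)
  have "poly (map_poly of_int (smult c p)) z = poly (map_poly of_int (g * s + r)) z" by (simp add: eq)
  then have "poly (map_poly of_int r) z = 0"
    using p gz by (simp add: map_poly_of_int_smult map_poly_of_int_mult map_poly_of_int_add)
  then have "r = 0" using linear_int_poly_root_nonreal im r by blast
  then have eq: "smult c p = g * s" using eq by simp
  have c0: "c \<noteq> 0" using g0 by (simp add: c_def)
  have "content p dvd 1" using content_dvd_coeff[of p "degree p"] p by simp
  then have cp: "content p = 1" by (metis is_unit_content_iff)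
  have "\<bar>c\<bar> = content s" using arg_cong[OF eq, of content] cg cp by (simp add: content_mult)
  then have "content s = c * sgn c" by (simp add: abs_sgn)
  then have "s = smult (c * sgn c) (primitive_part s)"
    using content_times_primitive_part[of s] by simp
  then have "smult c p = smult c (g * smult (sgn c) (primitive_part s))"
    using eq by (metis mult_smult_right smult_smult)
  then have "p = g * smult (sgn c) (primitive_part s)" using c0 smult_cancel by blast
  then have "lead_coeff g * lead_coeff (smult (sgn c) (primitive_part s)) = 1"
    using p(2) by (metis lead_coeff_mult)
  then have lg: "coeff g 2 = 1 \<or> coeff g 2 = -1" using zmult_eq_1_iff dg by auto
  have chg: "coeff h i = content h * coeff g i" for i using hg by (metis coeff_smult)
  \<comment> \<open>Since \<open>coeff g 2\<close> is a unit, \<open>a2 * b2\<close> divides the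
    content of \<open>h\<close>, hence all its coefficients; this removes both denominators.\<close>
  have "a2 * b2 = content h * coeff g 2" using chg[of 2] by (simp add: h_def numeral_2_eq_2)
  then have d: "a2 * b2 dvd content h"
    using lg by auto
  have "a2 * b2 dvd coeff h 0" "a2 * b2 dvd coeff h 1" by (rule dvd_trans[OF d content_dvd_coeff])+
  then have "a2 * b2 dvd b1 * a2" "a2 * b2 dvd a1 * b2" by (simp_all add: h_def)
  then have "b2 dvd b1" "a2 dvd a1" using a b by (simp_all add: mult.commute)
  then show ?thesis using a b by auto
qed

lemma rat_square_Ints:
  fixes q :: rat
  assumes "q * q = of_int k"
  shows "q \<in> \<int>"
proof (rule rational_algebraic_int_is_int)
  have "poly (map_poly of_int [:-k, 0, 1:]) q = 0"
    using assms by (simp add: map_poly_pCons)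
  then show "algebraic_int q" unfolding algebraic_int_altdef_ipoly
    by (intro exI[of _ "[:-k, 0, 1:]"]) auto
  show "q \<in> \<rat>" using Rats_of_rat[of q, where 'a = rat] by simp
qed

text \<open>Multiplying the hypothesis by \<open>- D\<close> makes its left side the square of
  \<open>x * D\<close>, which is integral by \<open>rat_square_Ints\<close>. This reads the shape of
  \<open>D\<close> off the norm equation of a unit.\<close>

lemma rat_square_times_int:
  fixes x :: rat
  assumes "x * x * (- of_int D) = of_int m"
  obtains f where "f * f = - D * m"
proof -
  have "(x * of_int D) * (x * of_int D) = x * x * (- of_int D) * of_int (- D)" by simp
  also have "\<dots> = of_int (- D * m)" unfolding assms by simp
  finally have c: "(x * of_int D) * (x * of_int D) = of_int (- D * m)" .
  obtain f where f: "x * of_int D = of_int f" using rat_square_Ints[OF c] by (auto elim: Ints_cases)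
  have "(of_int (f * f) :: rat) = of_int (- D * m)" using c unfolding f by simp
  then have "f * f = - D * m" by (simp only: of_int_eq_iff)
  then show ?thesis by (rule that)
qed

lemma cnj_of_rat [simp]: "cnj (of_rat a) = of_rat a"
  by (cases a) (simp add: of_rat_rat)

section \<open>The ring of integers through trace and norm\<close>

locale imag_quad =
  fixes D :: int
  assumes D_neg: "D < 0"
begin

definition w :: complex where "w = csqrt (of_int D)"

abbreviation "R \<equiv> ring_of_integers D"

lemma w_square: "w * w = of_int D"
  unfolding w_def by (metis power2_csqrt power2_eq_square)

lemma w_imag: "w = \<i> * of_real (sqrt (- of_int D))"
proof -
  have "csqrt (of_int D) = csqrt (of_real (of_int D))" by simp
  also have "\<dots> = \<i> * of_real (sqrt (- of_int D))"
    using D_neg by (subst csqrt_of_real_nonpos) auto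
  finally show ?thesis by (simp add: w_def)
qed

lemma cnj_w [simp]: "cnj w = - w"
  by (simp add: w_imag)

lemma Im_w: "Im w \<noteq> 0"
  using D_neg by (simp add: w_imag)

lemma quad_field_altdef: "quad_field D = {of_rat a + of_rat b * w | a b. True}"
  by (simp add: quad_field_def w_def)

lemma quad_fieldI: "z = of_rat a + of_rat b * w \<Longrightarrow> z \<in> quad_field D"
  by (auto simp: quad_field_altdef)

lemma quad_fieldE:
  assumes "z \<in> quad_field D"
  obtains a b where "z = of_rat a + of_rat b * w"
  using assms by (auto simp: quad_field_altdef)

lemma quad_field_add: 
  assumes "x \<in> quad_field D" "y \<in> quad_field D" shows "x + y \<in> quad_field D"
proof -
  obtain a b c d where "x = of_rat a + of_rat b * w" "y = of_rat c + of_rat d * w"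
    using assms by (auto elim!: quad_fieldE)
  then have "x + y = of_rat (a + c) + of_rat (b + d) * w"
    by (simp add: of_rat_add algebra_simps)
  then show ?thesis by (rule quad_fieldI)
qed

lemma quad_field_mult:
  assumes "x \<in> quad_field D" "y \<in> quad_field D" shows "x * y \<in> quad_field D"
proof -
  obtain a b c d where xy: "x = of_rat a + of_rat b * w" "y = of_rat c + of_rat d * w"
    using assms by (auto elim!: quad_fieldE)
  have "x * y = of_rat a * of_rat c + of_rat b * of_rat d * (w * w) + (of_rat a * of_rat d + of_rat b * of_rat c) * w"
    by (simp add: xy algebra_simps)
  then have "x * y = of_rat (a * c + b * d * of_int D) + of_rat (a * d + b * c) * w"
    by (simp add: w_square of_rat_add of_rat_mult)
  then show ?thesis by (rule quad_fieldI)
qed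

lemma quad_field_cnj:
  assumes "x \<in> quad_field D" shows "cnj x \<in> quad_field D"
proof -
  obtain a b where "x = of_rat a + of_rat b * w" using assms by (auto elim!: quad_fieldE)
  then have "cnj x = of_rat a + of_rat (- b) * w" by (simp add: of_rat_minus)
  then show ?thesis by (rule quad_fieldI)
qed

text \<open>Trace and norm replace an integral basis, so the square part of \<open>D\<close> never
  has to be extracted.\<close>

lemma ring_iff:
  "z \<in> R \<longleftrightarrow> z \<in> quad_field D \<and> (\<exists>a. z + cnj z = of_int a) \<and> (\<exists>b. z * cnj z = of_int b)"
proof (intro iffI)
  assume "z \<in> R"
  then have zK: "z \<in> quad_field D" and alg: "algebraic_int z"
    by (auto simp: ring_of_integers_def alg_int_iff)
  obtain a b where z: "z = of_rat a + of_rat b * w" using zK by (auto elim!: quad_fieldE)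
  show "z \<in> quad_field D \<and> (\<exists>a. z + cnj z = of_int a) \<and> (\<exists>b. z * cnj z = of_int b)"
  \<comment> \<open>\<open>algebraic_int_trace_norm\<close> wants a nonreal \<open>z\<close>; a real
    element of the field is rational because \<open>w\<close> is purely imaginary.\<close>
  proof (cases "Im z = 0")
    case True
    have "of_rat b = complex_of_real (of_rat b)" by (cases b) (simp add: of_rat_rat)
    moreover have "of_rat a = complex_of_real (of_rat a)" by (cases a) (simp add: of_rat_rat)
    ultimately have "b = 0" using True Im_w by (auto simp: z)
    then have "z \<in> \<rat>" by (simp add: z)
    then have "z \<in> \<int>" using alg rational_algebraic_int_is_int by blast
    then obtain k where "z = of_int k" by (auto elim: Ints_cases)
    then have "z + cnj z = of_int (2 * k)" "z * cnj z = of_int (k * k)" by auto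
    then show ?thesis using zK by blast
  next
    case False
    have t: "z + cnj z = of_rat (2 * a)" by (simp add: z of_rat_mult)
    have "z * cnj z = of_rat a * of_rat a - of_rat b * of_rat b * (w * w)"
      by (simp add: z algebra_simps)
    then have n: "z * cnj z = of_rat (a * a - b * b * of_int D)"
      by (simp add: w_square of_rat_mult of_rat_diff)
    have "2 * a \<in> \<int> \<and> a * a - b * b * of_int D \<in> \<int>"
      by (rule algebraic_int_trace_norm[OF alg False t n])
    then obtain k l where "2 * a = of_int k" "a * a - b * b * of_int D = of_int l"
      by (auto elim!: Ints_cases)
    then show ?thesis using zK t n by auto
  qed
next
  assume "z \<in> quad_field D \<and> (\<exists>a. z + cnj z = of_int a) \<and> (\<exists>b. z * cnj z = of_int b)"
  then show "z \<in> R" using quad_algebraic_int by (auto simp: ring_of_integers_def alg_int_iff)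
qed

lemma ringI:
  "z \<in> quad_field D \<Longrightarrow> z + cnj z = of_int a \<Longrightarrow> z * cnj z = of_int b \<Longrightarrow> z \<in> R"
  by (auto simp: ring_iff)

lemma ring_quad_field: "z \<in> R \<Longrightarrow> z \<in> quad_field D"
  by (simp add: ring_iff)

lemma ringE:
  assumes "z \<in> R" obtains a b where "z = of_rat a + of_rat b * w"
  using assms ring_quad_field quad_fieldE by blast

lemma ring_traceE:
  assumes "z \<in> R" obtains a where "z + cnj z = of_int a"
  using assms by (auto simp: ring_iff)

lemma ring_normE:
  assumes "z \<in> R" obtains b where "z * cnj z = of_int b"
  using assms by (auto simp: ring_iff)

text \<open>\<open>\<delta> = x - cnj x\<close> and \<open>\<delta>' = y - cnj y\<close> have rational product, whose square is an
  integer congruent to the square of the product of the traces modulo 4.\<close>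
lemma ring_trace_mult_cnj:
  assumes "x \<in> R" "y \<in> R"
  obtains m where "x * cnj y + cnj x * y = of_int m"
proof -
  obtain t n where x: "x + cnj x = of_int t" "x * cnj x = of_int n" using assms by (auto simp: ring_iff)
  obtain t' n' where y: "y + cnj y = of_int t'" "y * cnj y = of_int n'" using assms by (auto simp: ring_iff)
  obtain a b c d where xy: "x = of_rat a + of_rat b * w" "y = of_rat c + of_rat d * w"
    using assms by (auto elim!: ringE)
  define e where "e = (x - cnj x) * (y - cnj y)"
  have "e = 4 * (of_rat b * of_rat d) * (w * w)" by (simp add: e_def xy algebra_simps)
  then have er: "e = of_rat (4 * b * d * of_int D)" by (simp add: w_square of_rat_mult)
  have "e * e = ((x + cnj x)\<^sup>2 - 4 * (x * cnj x)) * ((y + cnj y)\<^sup>2 - 4 * (y * cnj y))"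
    by (simp add: e_def power2_eq_square algebra_simps)
  then have ee: "e * e = of_int ((t\<^sup>2 - 4 * n) * (t'\<^sup>2 - 4 * n'))" by (simp add: x y)
  define q where "q = 4 * b * d * of_int D"
  have "of_rat (q * q) = (of_rat (of_int ((t\<^sup>2 - 4 * n) * (t'\<^sup>2 - 4 * n'))) :: complex)"
    using ee er by (simp only: of_rat_mult of_rat_of_int_eq q_def)
  then have "q * q = of_int ((t\<^sup>2 - 4 * n) * (t'\<^sup>2 - 4 * n'))" by (simp only: of_rat_eq_iff)
  then have "q \<in> \<int>" by (rule rat_square_Ints)
  then obtain k where "q = of_int k" by (auto elim: Ints_cases)
  then have ek: "e = of_int k" using er by (simp add: q_def[symmetric])
  have "(of_int (k * k) :: complex) = of_int ((t\<^sup>2 - 4 * n) * (t'\<^sup>2 - 4 * n'))" using ee ek by simp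
  then have "k * k = (t\<^sup>2 - 4 * n) * (t'\<^sup>2 - 4 * n')" by (simp only: of_int_eq_iff)
  then have "even (k * k) \<longleftrightarrow> even ((t\<^sup>2 - 4 * n) * (t'\<^sup>2 - 4 * n'))" by simp
  then have "even (t * t' - k)" by auto
  then obtain m where m: "t * t' - k = 2 * m" by blast
  have "2 * (x * cnj y + cnj x * y) = (x + cnj x) * (y + cnj y) - e"
    by (simp add: e_def algebra_simps)
  also have "\<dots> = of_int (t * t' - k)" by (simp add: x y ek)
  finally have "2 * (x * cnj y + cnj x * y) = 2 * of_int m" unfolding m by simp
  then have "x * cnj y + cnj x * y = of_int m" by (metis mult_cancel_left zero_neq_numeral)
  then show ?thesis using that by blast
qed

text \<open>The norm of the sum contains the cross term \<open>x * cnj y + cnj x * y\<close>, an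
  integer by \<open>ring_trace_mult_cnj\<close>; for products the same term appears in the
  trace.\<close>

lemma ring_add: assumes "x \<in> R" "y \<in> R" shows "x + y \<in> R"
proof -
  obtain t n where x: "x + cnj x = of_int t" "x * cnj x = of_int n" using assms by (auto simp: ring_iff)
  obtain t' n' where y: "y + cnj y = of_int t'" "y * cnj y = of_int n'" using assms by (auto simp: ring_iff)
  obtain m where m: "x * cnj y + cnj x * y = of_int m" using ring_trace_mult_cnj assms by blast
  have "(x + y) + cnj (x + y) = (x + cnj x) + (y + cnj y)" by simp
  then have 1: "(x + y) + cnj (x + y) = of_int (t + t')" by (simp only: x y of_int_add)
  have "(x + y) * cnj (x + y) = x * cnj x + y * cnj y + (x * cnj y + cnj x * y)"
    by (simp add: algebra_simps)
  then have 2: "(x + y) * cnj (x + y) = of_int (n + n' + m)" by (simp only: x y m of_int_add)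
  show ?thesis using assms by (intro ringI[OF _ 1 2] quad_field_add) (simp_all add: ring_quad_field)
qed

lemma ring_mult: assumes "x \<in> R" "y \<in> R" shows "x * y \<in> R"
proof -
  obtain t n where x: "x + cnj x = of_int t" "x * cnj x = of_int n" using assms by (auto simp: ring_iff)
  obtain t' n' where y: "y + cnj y = of_int t'" "y * cnj y = of_int n'" using assms by (auto simp: ring_iff)
  obtain m where m: "x * cnj y + cnj x * y = of_int m" using ring_trace_mult_cnj assms by blast
  have "x * y + cnj (x * y) = (x + cnj x) * (y + cnj y) - (x * cnj y + cnj x * y)"
    by (simp add: algebra_simps)
  then have 1: "x * y + cnj (x * y) = of_int (t * t' - m)" by (simp only: x y m of_int_mult of_int_diff)
  have "(x * y) * cnj (x * y) = (x * cnj x) * (y * cnj y)" by simp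
  then have 2: "(x * y) * cnj (x * y) = of_int (n * n')" by (simp only: x y of_int_mult)
  show ?thesis using assms by (intro ringI[OF _ 1 2] quad_field_mult) (simp_all add: ring_quad_field)
qed

lemma ring_cnj: "x \<in> R \<Longrightarrow> cnj x \<in> R"
  by (auto simp: ring_iff quad_field_cnj add.commute mult.commute)

lemma ring_of_int [simp]: "of_int k \<in> R"
proof (rule ringI)
  show "of_int k \<in> quad_field D" by (rule quad_fieldI[of _ "of_int k" 0]) simp
  show "of_int k + cnj (of_int k) = of_int (k + k)" "of_int k * cnj (of_int k) = of_int (k * k)"
    by simp_all
qed

lemma ring_of_nat [simp]: "of_nat k \<in> R"
  using ring_of_int[of "int k"] by simp

lemma ring_0 [simp]: "0 \<in> R" and ring_1 [simp]: "1 \<in> R"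
  using ring_of_int[of 0] ring_of_int[of 1] by simp_all

lemma ring_power: "x \<in> R \<Longrightarrow> x ^ k \<in> R"
  by (induction k) (auto simp: ring_mult)

text \<open>The trace \<open>t\<close> satisfies \<open>4 - t * t = - D * (2 * b) ^ 2\<close>, which
  is nonnegative, so \<open>\<bar>t\<bar> \<le> 2\<close>. The values 0 and 1, -1 give the roots of
  unity of order 4 and of order 6, 3; there the norm equation fixes \<open>D\<close> up to a square
  factor.\<close>

lemma unit_cases:
  assumes "u \<in> R" "u * cnj u = 1"
  shows "u = 1 \<or> u = -1 \<or> (u\<^sup>2 = -1 \<and> (\<exists>f. D = - (f\<^sup>2))) 
    \<or> ((u ^ 3 = 1 \<or> u ^ 3 = -1) \<and> (\<exists>f. D = - 3 * f\<^sup>2))"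
proof -
  obtain t where t: "u + cnj u = of_int t" using assms by (auto elim: ring_traceE)
  obtain a b where u: "u = of_rat a + of_rat b * w"
    using assms by (auto elim!: ringE)
  have quad: "u * u - of_int t * u + 1 = 0"
    unfolding t[symmetric] assms(2)[symmetric] by (simp add: algebra_simps)
  have "(of_rat (2 * a) :: complex) = of_rat (of_int t)"
    using t by (simp add: u of_rat_mult)
  then have ta: "2 * a = of_int t" by (simp only: of_rat_eq_iff)
  have "of_rat a * of_rat a - of_rat b * of_rat b * (w * w) = 1"
    using assms(2) by (simp add: u algebra_simps)
  then have "(of_rat (a * a - b * b * of_int D) :: complex) = of_rat 1"
    by (simp add: w_square of_rat_mult of_rat_diff)
  then have nab: "a * a - b * b * of_int D = 1" by (simp only: of_rat_eq_iff)
  have eq: "(2 * b) * (2 * b) * (- of_int D) = 4 - of_int (t * t)"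
  proof -
    have "(of_int (t * t) :: rat) = (2 * a) * (2 * a)" by (simp add: ta)
    then show ?thesis using nab by (simp add: algebra_simps)
  qed
  have "(0::rat) \<le> (2 * b) * (2 * b) * (- of_int D)"
    using D_neg by (intro mult_nonneg_nonneg[OF zero_le_square]) auto
  then have "(of_int (t * t) :: rat) \<le> of_int 4" unfolding eq by simp
  then have "t * t \<le> 4" by (simp only: of_int_le_iff)
  then have "\<bar>t\<bar> \<le> 2" using abs_le_square_iff[of t 2] by (simp add: power2_eq_square)
  then consider "t = 2" | "t = -2" | "t = 0" | "t = 1" | "t = -1" by linarith
  then show ?thesis
  proof cases
    case 1
    then have "(u - 1) * (u - 1) = 0" using quad by (simp add: algebra_simps)
    then show ?thesis by simp
  next
    case 2
    then have "(u + 1) * (u + 1) = 0" using quad by (simp add: algebra_simps)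
    then have "u + 1 = 0" by simp
    then have "u = - 1" by (simp only: eq_neg_iff_add_eq_0)
    then show ?thesis by simp
  next
    case 3
    have uu: "u\<^sup>2 = -1" using quad 3 by (simp add: power2_eq_square eq_neg_iff_add_eq_0)
    have "b * b * (- of_int D) = of_int 1" using nab ta 3 by simp
    then obtain f where "f * f = - D * 1" by (rule rat_square_times_int)
    then have "D = - (f\<^sup>2)" by (simp add: power2_eq_square)
    then show ?thesis using uu by blast
  next
    case 4
    have "(u + 1) * (u * u - u + 1) = u ^ 3 + 1" by (simp add: power3_eq_cube algebra_simps)
    then have u3: "u ^ 3 = -1" using quad 4 by (simp add: eq_neg_iff_add_eq_0)
    have "(2 * b) * (2 * b) * (- of_int D) = of_int 3" using eq 4 by simp
    then obtain f where f: "f * f = - D * 3" by (rule rat_square_times_int)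
    then have "3 dvd f * f" by simp
    then have "3 dvd f" using prime_dvd_multD[of "3::int" f f] by auto
    then obtain g where "f = 3 * g" by blast
    then have "D = - 3 * g\<^sup>2" using f by (simp add: power2_eq_square)
    then show ?thesis using u3 by blast
  next
    case 5
    have "(u - 1) * (u * u + u + 1) = u ^ 3 - 1" by (simp add: power3_eq_cube algebra_simps)
    then have u3: "u ^ 3 = 1" using quad 5 by simp
    have "(2 * b) * (2 * b) * (- of_int D) = of_int 3" using eq 5 by simp
    then obtain f where f: "f * f = - D * 3" by (rule rat_square_times_int)
    then have "3 dvd f * f" by simp
    then have "3 dvd f" using prime_dvd_multD[of "3::int" f f] by auto
    then obtain g where "f = 3 * g" by blast
    then have "D = - 3 * g\<^sup>2" using f by (simp add: power2_eq_square)
    then show ?thesis using u3 by blast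
  qed
qed

end

subsection \<open>Powers of a split prime\<close>

text \<open>The companion Lucas sequence: the sum of the \<open>k\<close>-th powers of the two roots
  of \<open>X ^ 2 - c * X + q\<close>, that is, the trace of the \<open>k\<close>-th power of an
  element with trace \<open>c\<close> and norm \<open>q\<close>.\<close>

fun lucas_V :: "int \<Rightarrow> int \<Rightarrow> nat \<Rightarrow> int" where
  "lucas_V c q 0 = 2"
| "lucas_V c q (Suc 0) = c"
| "lucas_V c q (Suc (Suc k)) = c * lucas_V c q (Suc k) - q * lucas_V c q k"

lemma lucas_V_power_sum:
  fixes x y :: "'a :: comm_ring_1"
  assumes "x + y = of_int c" "x * y = of_int q"
  shows "x ^ k + y ^ k = of_int (lucas_V c q k)"
proof (induction k rule: induct_nat_012)
  case (ge2 k)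
  have "x ^ Suc (Suc k) + y ^ Suc (Suc k) = (x + y) * (x ^ Suc k + y ^ Suc k) - (x * y) * (x ^ k + y ^ k)"
    by (simp add: algebra_simps)
  then show ?case using ge2 by (simp add: assms)
qed (simp_all add: assms)

lemma coprime_bezout_int:
  fixes a b :: int
  assumes "coprime a b"
  obtains x y where "x * a + y * b = 1"
  using bezout_int[of a b] assms by (auto simp: coprime_iff_gcd_eq_1)

lemma is_idealD:
  assumes "is_ideal R I"
  shows "x \<in> I \<Longrightarrow> x \<in> R" "0 \<in> I" "x \<in> I \<Longrightarrow> y \<in> I \<Longrightarrow> x + y \<in> I"
    "r \<in> R \<Longrightarrow> x \<in> I \<Longrightarrow> r * x \<in> I" "r \<in> R \<Longrightarrow> x \<in> I \<Longrightarrow> x * r \<in> I"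
  using assms by (auto simp: is_ideal_def mult.commute)

lemma ideal_gen_eqI:
  assumes "is_ideal R J" "S \<subseteq> J" "\<And>K. is_ideal R K \<Longrightarrow> S \<subseteq> K \<Longrightarrow> J \<subseteq> K"
  shows "ideal_gen R S = J"
  using assms unfolding ideal_gen_def by blast

section \<open>Products of ideals with two generators\<close>

context imag_quad
begin

definition ideal2 :: "complex \<Rightarrow> complex \<Rightarrow> complex set" where
  "ideal2 a b = {a * x + b * y | x y. x \<in> R \<and> y \<in> R}"

lemma ideal2I: "z = a * x + b * y \<Longrightarrow> x \<in> R \<Longrightarrow> y \<in> R \<Longrightarrow> z \<in> ideal2 a b"
  by (auto simp: ideal2_def)

lemma ideal2E:
  assumes "z \<in> ideal2 a b" obtains x y where "z = a * x + b * y" "x \<in> R" "y \<in> R"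
  using assms by (auto simp: ideal2_def)

lemma is_ideal_ideal2:
  assumes "a \<in> R" "b \<in> R" shows "is_ideal R (ideal2 a b)"
  unfolding is_ideal_def
proof (intro conjI ballI subsetI)
  show "0 \<in> ideal2 a b" by (rule ideal2I[of _ _ 0 _ 0]) auto
  fix z assume "z \<in> ideal2 a b"
  then obtain x y where z: "z = a * x + b * y" "x \<in> R" "y \<in> R" by (rule ideal2E)
  then show "z \<in> R" using assms by (auto intro!: ring_add ring_mult)
  fix z' assume "z' \<in> ideal2 a b"
  then obtain x' y' where z': "z' = a * x' + b * y'" "x' \<in> R" "y' \<in> R" by (rule ideal2E)
  show "z + z' \<in> ideal2 a b" using z z'
    by (intro ideal2I[of _ _ "x + x'" _ "y + y'"]) (auto simp: algebra_simps intro!: ring_add)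
next
  fix r z assume r: "r \<in> R" and "z \<in> ideal2 a b"
  then obtain x y where z: "z = a * x + b * y" "x \<in> R" "y \<in> R" by (auto elim: ideal2E)
  show "r * z \<in> ideal2 a b" using z r
    by (intro ideal2I[of _ _ "r * x" _ "r * y"]) (auto simp: algebra_simps intro!: ring_mult)
qed

lemma ideal2_mem: "a \<in> ideal2 a b" "b \<in> ideal2 a b"
  by (auto intro: ideal2I[of _ _ 1 _ 0] ideal2I[of _ _ 0 _ 1])

lemma ideal2_subset:
  assumes "is_ideal R K" "a \<in> K" "b \<in> K" shows "ideal2 a b \<subseteq> K"
  using is_idealD[OF assms(1)] assms(2,3) by (auto simp: ideal2_def)

lemma ideal2_0: "ideal2 a 0 = principal_ideal R a"
  unfolding ideal2_def principal_ideal_def using ring_0 by auto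

text \<open>The four products of generators and the pair \<open>e\<close>, \<open>f\<close> must
  generate the same ideal. The second half is asked inside an arbitrary ideal \<open>K\<close>,
  where Bezout combinations can be formed directly.\<close>

lemma ideal2_mult:
  assumes R: "a \<in> R" "b \<in> R" "c \<in> R" "d \<in> R" "e \<in> R" "f \<in> R"
    and le: "a * c \<in> ideal2 e f" "a * d \<in> ideal2 e f" "b * c \<in> ideal2 e f" "b * d \<in> ideal2 e f"
    and ge: "\<And>K. is_ideal R K \<Longrightarrow> a * c \<in> K \<Longrightarrow> a * d \<in> K \<Longrightarrow> b * c \<in> K \<Longrightarrow> b * d \<in> K \<Longrightarrow> e \<in> K \<and> f \<in> K"
  shows "ideal_mult R (ideal2 a b) (ideal2 c d) = ideal2 e f"
  unfolding ideal_mult_def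
proof (rule ideal_gen_eqI)
  show id: "is_ideal R (ideal2 e f)" by (rule is_ideal_ideal2) (use R in auto)
  show "{x * y |x y. x \<in> ideal2 a b \<and> y \<in> ideal2 c d} \<subseteq> ideal2 e f"
  proof safe
    fix x y assume "x \<in> ideal2 a b" "y \<in> ideal2 c d"
    then obtain s t u v where x: "x = a * s + b * t" "s \<in> R" "t \<in> R" and y: "y = c * u + d * v" "u \<in> R" "v \<in> R"
      by (auto elim!: ideal2E)
    have "x * y = s * u * (a * c) + s * v * (a * d) + t * u * (b * c) + t * v * (b * d)"
      by (simp add: x y algebra_simps)
    then show "x * y \<in> ideal2 e f" using le x y by (auto intro!: is_idealD(3,4)[OF id] ring_mult)
  qed
  fix K assume K: "is_ideal R K" "{x * y |x y. x \<in> ideal2 a b \<and> y \<in> ideal2 c d} \<subseteq> K"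
  have "x * y \<in> K" if "x \<in> ideal2 a b" "y \<in> ideal2 c d" for x y using K(2) that by blast
  then have "e \<in> K \<and> f \<in> K" by (intro ge K(1)) (simp_all add: ideal2_mem)
  then show "ideal2 e f \<subseteq> K" using K(1) by (intro ideal2_subset) simp_all
qed

lemma ideal_mult_principal:
  assumes "a \<in> R" "c \<in> R" "d \<in> R"
  shows "ideal_mult R (principal_ideal R a) (ideal2 c d) = ideal2 (a * c) (a * d)"
  unfolding ideal2_0[symmetric] using assms
  by (intro ideal2_mult) (auto simp: ideal2_mem intro: ring_mult ideal2I[of _ _ 0 _ 0])

lemma principal_mult:
  assumes "a \<in> R" "c \<in> R"
  shows "ideal_mult R (principal_ideal R a) (principal_ideal R c) = principal_ideal R (a * c)"
  using ideal_mult_principal[OF assms ring_0] by (simp add: ideal2_0)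

end

section \<open>The prime ideal above p and its powers\<close>

locale split_prime = imag_quad +
  fixes p n :: nat and t :: int and \<alpha> :: complex
  assumes p: "prime p" and n: "n > 0" and \<alpha>: "\<alpha> \<in> R"
    and tr: "\<alpha> + cnj \<alpha> = of_int t" and nm: "\<alpha> * cnj \<alpha> = of_nat (p ^ n)"
    and cop: "coprime t (int p)"
begin

definition I :: "nat \<Rightarrow> complex set" where
  "I j = ideal2 (of_nat (p ^ j)) \<alpha>"

lemma cnj_split_prime: "split_prime D p n t (cnj \<alpha>)"
  using p n ring_cnj[OF \<alpha>] tr nm cop
  by unfold_locales (simp_all add: add.commute mult.commute)

lemma is_ideal_I: "is_ideal R (I j)"
  unfolding I_def by (rule is_ideal_ideal2) (simp_all add: \<alpha> ring_power del: of_nat_power)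

text \<open>The point is to find \<open>\<alpha>\<close> in the product. It contains
  \<open>\<alpha> * \<alpha> + p ^ n = t * \<alpha>\<close>, where \<open>i + j \<le> n\<close> is
  used, and also \<open>p ^ i * \<alpha>\<close>; the factors \<open>t\<close> and
  \<open>p ^ i\<close> are coprime.\<close>

lemma I_mult:
  assumes "i + j \<le> n"
  shows "ideal_mult R (I i) (I j) = I (i + j)"
  unfolding I_def
proof (rule ideal2_mult)
  show "of_nat (p ^ i) * \<alpha> \<in> ideal2 (of_nat (p ^ (i + j))) \<alpha>"
    by (rule ideal2I[of _ _ 0 _ "of_nat (p ^ i)"]) (simp_all del: of_nat_power)
  show "\<alpha> * of_nat (p ^ j) \<in> ideal2 (of_nat (p ^ (i + j))) \<alpha>"
    by (rule ideal2I[of _ _ 0 _ "of_nat (p ^ j)"]) (simp_all del: of_nat_power)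
  show "\<alpha> * \<alpha> \<in> ideal2 (of_nat (p ^ (i + j))) \<alpha>"
    by (rule ideal2I[of _ _ 0 _ \<alpha>]) (simp_all add: \<alpha>)
  show "of_nat (p ^ i) * of_nat (p ^ j) \<in> ideal2 (of_nat (p ^ (i + j))) \<alpha>"
    using ideal2_mem by (simp add: power_add)
next
  fix K assume K: "is_ideal R K" "of_nat (p ^ i) * of_nat (p ^ j) \<in> K" "of_nat (p ^ i) * \<alpha> \<in> K"
    "\<alpha> * \<alpha> \<in> K"
  have e: "of_nat (p ^ (i + j)) \<in> K" using K by (simp add: power_add)
  have "of_nat (p ^ n) = (of_nat (p ^ (n - (i + j))) * of_nat (p ^ (i + j)) :: complex)"
    using assms by (simp flip: of_nat_mult power_add)
  then have pn: "of_nat (p ^ n) \<in> K"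
    using is_idealD(4)[OF K(1) ring_of_nat e] by metis
  have "of_int t * \<alpha> = \<alpha> * \<alpha> + of_nat (p ^ n)"
    unfolding tr[symmetric] nm[symmetric] by (simp add: algebra_simps)
  then have t\<alpha>: "of_int t * \<alpha> \<in> K" using is_idealD(3)[OF K(1) K(4) pn] by simp
  have "coprime t (int p ^ i)" using cop by simp
  then obtain x y where xy: "x * t + y * int p ^ i = 1"
    by (rule coprime_bezout_int)
  have "\<alpha> = of_int (x * t + y * int p ^ i) * \<alpha>" unfolding xy by simp
  also have "\<dots> = of_int x * (of_int t * \<alpha>) + of_int y * (of_nat (p ^ i) * \<alpha>)"
    by (simp add: algebra_simps)
  also have "\<dots> \<in> K" using is_idealD(3)[OF K(1) is_idealD(4)[OF K(1) ring_of_int t\<alpha>] is_idealD(4)[OF K(1) ring_of_int K(3)]] .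
  finally show "of_nat (p ^ (i + j)) \<in> K \<and> \<alpha> \<in> K" using e by blast
qed (simp_all add: \<alpha> ring_power del: of_nat_power)

lemma I_0: "I 0 = R"
proof
  show "I 0 \<subseteq> R" using is_ideal_I by (auto simp: is_ideal_def)
  show "R \<subseteq> I 0" unfolding I_def by (auto intro: ideal2I[of _ _ _ _ 0])
qed

lemma I_n: "I n = principal_ideal R \<alpha>"
proof
  have id: "is_ideal R (principal_ideal R \<alpha>)" using is_ideal_ideal2[of \<alpha> 0] \<alpha> by (simp add: ideal2_0)
  have "\<alpha> \<in> principal_ideal R \<alpha>" unfolding ideal2_0[symmetric] by (rule ideal2_mem)
  moreover have "of_nat (p ^ n) \<in> principal_ideal R \<alpha>"
    unfolding nm[symmetric] principal_ideal_def using ring_cnj[OF \<alpha>] by blast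
  ultimately show "I n \<subseteq> principal_ideal R \<alpha>" unfolding I_def by (intro ideal2_subset id)
  show "principal_ideal R \<alpha> \<subseteq> I n" unfolding ideal2_0[symmetric]
    by (rule ideal2_subset[OF is_ideal_I]) (auto simp: I_def ideal2_mem intro: ideal2I[of _ _ 0 _ 0])
qed

lemma ideal_pow_I: "j \<le> n \<Longrightarrow> ideal_pow R (I 1) j = I j"
proof (induction j)
  case (Suc j)
  then show ?case using I_mult[of 1 j] by simp
qed (simp add: I_0)

text \<open>All four products of generators are multiples of \<open>p\<close>. Conversely
  \<open>p\<close> is a combination of \<open>p * p\<close> and
  \<open>p * t = p * \<alpha> + p * cnj \<alpha>\<close>, as \<open>t\<close> is prime to
  \<open>p\<close>.\<close>

lemma I_1_mult_cnj: "ideal_mult R (I 1) (split_prime.I D p (cnj \<alpha>) 1) = principal_ideal R (of_nat p)"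
  unfolding I_def split_prime.I_def[OF cnj_split_prime] ideal2_0[symmetric]
proof (rule ideal2_mult)
  have *: "a * b \<in> ideal2 a 0" "b * a \<in> ideal2 a 0" if "b \<in> R" for a b
    using that by (auto intro: ideal2I[of _ _ b _ 0])
  show "of_nat (p ^ 1) * of_nat (p ^ 1) \<in> ideal2 (of_nat p) 0" "of_nat (p ^ 1) * cnj \<alpha> \<in> ideal2 (of_nat p) 0"
    "\<alpha> * of_nat (p ^ 1) \<in> ideal2 (of_nat p) 0"
    using * \<alpha> ring_cnj by simp_all
  have "p ^ n = p * p ^ (n - 1)" using n by (cases n) auto
  then show "\<alpha> * cnj \<alpha> \<in> ideal2 (of_nat p) 0" unfolding nm by (simp add: * ring_power)
next
  fix K assume K: "is_ideal R K" "of_nat (p ^ 1) * of_nat (p ^ 1) \<in> K" "of_nat (p ^ 1) * cnj \<alpha> \<in> K"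
    "\<alpha> * of_nat (p ^ 1) \<in> K"
  obtain x y where xy: "x * t + y * int p = 1" using cop
    by (rule coprime_bezout_int)
  have "of_nat p = of_int (x * t + y * int p) * (of_nat p :: complex)" unfolding xy by simp
  also have "\<dots> = of_int x * (\<alpha> * of_nat (p ^ 1) + of_nat (p ^ 1) * cnj \<alpha>) + of_int y * (of_nat (p ^ 1) * of_nat (p ^ 1))"
    by (simp add: tr[symmetric] algebra_simps)
  also have "\<dots> \<in> K" using is_idealD(3)[OF K(1) is_idealD(4)[OF K(1) ring_of_int is_idealD(3)[OF K(1) K(4) K(3)]]
        is_idealD(4)[OF K(1) ring_of_int K(2)]] .
  finally show "of_nat p \<in> K \<and> 0 \<in> K" using is_idealD[OF K(1)] by blast
qed (simp_all add: \<alpha> ring_cnj)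

text \<open>Multiplying the membership by \<open>cnj \<alpha>\<close> gives
  \<open>c * cnj \<alpha> = p * z\<close> with \<open>z\<close> integral; taking traces,
  \<open>p\<close> divides \<open>c * t\<close>.\<close>

lemma of_int_mem_I_1:
  assumes "of_int c \<in> I 1" shows "int p dvd c"
proof -
  obtain x y where xy: "of_int c = of_nat p * x + \<alpha> * y" "x \<in> R" "y \<in> R"
    using assms by (auto simp: I_def elim: ideal2E)
  define z where "z = x * cnj \<alpha> + of_nat (p ^ (n - 1)) * y"
  have z: "z \<in> R" unfolding z_def using xy \<alpha> by (intro ring_add ring_mult ring_cnj ring_of_nat)
  have "p ^ n = p * p ^ (n - 1)" using n by (cases n) auto
  then have pn: "\<alpha> * cnj \<alpha> = of_nat p * of_nat (p ^ (n - 1))" unfolding nm by simp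
  have "of_int c * cnj \<alpha> = of_nat p * x * cnj \<alpha> + \<alpha> * cnj \<alpha> * y" unfolding xy by (simp add: algebra_simps)
  also have "\<dots> = of_nat p * z" unfolding z_def pn by (simp add: algebra_simps)
  finally have 1: "of_int c * cnj \<alpha> = of_nat p * z" .
  then have 2: "of_int c * \<alpha> = of_nat p * cnj z" by (metis complex_cnj_cnj complex_cnj_mult complex_cnj_of_int complex_cnj_of_nat)
  obtain k where k: "z + cnj z = of_int k" using z by (auto elim: ring_traceE)
  have "of_int (c * t) = of_int c * (\<alpha> + cnj \<alpha>)" by (simp add: tr)
  also have "\<dots> = of_nat p * (z + cnj z)" using 1 2 by (simp add: algebra_simps)
  also have "\<dots> = of_int (int p * k)" by (simp add: k)
  finally have "c * t = int p * k" by (simp only: of_int_eq_iff)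
  then have "int p dvd c * t" by simp
  then show ?thesis using cop by (simp add: coprime_commute coprime_dvd_mult_left_iff)
qed

text \<open>The discriminant of \<open>\<int>[\<alpha>]\<close> annihilates \<open>R / \<int>[\<alpha>]\<close> and is prime to \<open>p\<close>.\<close>
lemma ring_residue:
  assumes x: "x \<in> R" obtains c where "x - of_int c \<in> I 1"
proof -
  obtain a where a: "x + cnj x = of_int a" using x by (auto elim: ring_traceE)
  obtain m where m: "x * cnj \<alpha> + cnj x * \<alpha> = of_int m" using ring_trace_mult_cnj[OF x \<alpha>] by blast
  define d where "d = t * t - 4 * int p ^ n"
  have "\<not> int p dvd d"
  proof
    assume "int p dvd d"
    moreover have "int p dvd 4 * int p ^ n" using n by (simp add: dvd_power)
    ultimately have "int p dvd d + 4 * int p ^ n" by (rule dvd_add)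
    then have "int p dvd t" using p by (auto simp: d_def prime_dvd_mult_iff)
    then have "is_unit (int p)" using coprime_common_divisor[OF cop _ dvd_refl] by blast
    then show False using p by auto
  qed
  then have "coprime d (int p)" using p by (metis coprime_commute prime_imp_coprime prime_nat_int_transfer)
  then obtain y z where yz: "y * d + z * int p = 1"
    by (rule coprime_bezout_int)
  define q where "q = int p ^ n"
  have q: "(of_int q :: complex) = \<alpha> * cnj \<alpha>" unfolding nm q_def by simp
  \<comment> \<open>Cramer's rule, free of division: the coordinates of \<open>x\<close> on 1 and
    \<open>\<alpha>\<close> are found from the traces \<open>a\<close> of \<open>x\<close> and
    \<open>m\<close> of \<open>x * cnj \<alpha>\<close>, with determinant \<open>d\<close> up to
    sign.\<close>
  have "of_int d * x = ((\<alpha> + cnj \<alpha>) * (\<alpha> + cnj \<alpha>) - 4 * (\<alpha> * cnj \<alpha>)) * x"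
    unfolding tr q[symmetric] d_def q_def by simp
  also have "\<dots> = (\<alpha> + cnj \<alpha>) * (x * cnj \<alpha> + cnj x * \<alpha>) - 2 * (\<alpha> * cnj \<alpha>) * (x + cnj x)
      + ((\<alpha> + cnj \<alpha>) * (x + cnj x) - 2 * (x * cnj \<alpha> + cnj x * \<alpha>)) * \<alpha>"
    by (simp add: algebra_simps)
  also have "\<dots> = of_int (t * m - 2 * q * a) + of_int (t * a - 2 * m) * \<alpha>"
    unfolding a m tr q[symmetric] by simp
  finally have dx: "of_int d * x = of_int (t * m - 2 * q * a) + of_int (t * a - 2 * m) * \<alpha>" .
  have "x = of_int (y * d + z * int p) * x" unfolding yz by simp
  also have "\<dots> = of_int y * (of_int d * x) + of_nat p * (of_int z * x)" by (simp add: algebra_simps)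
  also have "\<dots> = of_int (y * (t * m - 2 * q * a)) + (of_nat p * (of_int z * x) + \<alpha> * of_int (y * (t * a - 2 * m)))"
    unfolding dx by (simp add: algebra_simps)
  finally have "x - of_int (y * (t * m - 2 * q * a)) = of_nat p * (of_int z * x) + \<alpha> * of_int (y * (t * a - 2 * m))"
    by (simp only: diff_eq_eq) (simp add: algebra_simps)
  then have "x - of_int (y * (t * m - 2 * q * a)) \<in> I 1"
    unfolding I_def power_one_right by (rule ideal2I[OF _ ring_mult[OF ring_of_int x] ring_of_int])
  then show ?thesis by (rule that)
qed

lemma p_mem_I_1: "of_nat p \<in> I 1"
  unfolding I_def using ideal2_mem[of "of_nat (p ^ 1)"] by simp

text \<open>By \<open>ring_residue\<close> and \<open>of_int_mem_I_1\<close> the quotient of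
  \<open>R\<close> by \<open>I 1\<close> is the field of integers modulo \<open>p\<close>.\<close>

lemma prime_ideal_I_1: "prime_ideal R (I 1)"
  unfolding prime_ideal_def
proof (intro conjI ballI impI)
  note id = is_idealD[OF is_ideal_I]
  show "is_ideal R (I 1)" by (rule is_ideal_I)
  show "I 1 \<noteq> {0}" using p_mem_I_1 p by (auto simp: prime_gt_0_nat)
  have "of_int 1 \<notin> I 1" using of_int_mem_I_1[of 1] p by auto
  then show "I 1 \<noteq> R" using ring_of_int by metis
  fix x y assume x: "x \<in> R" and y: "y \<in> R" and xy: "x * y \<in> I 1"
  obtain c where c: "x - of_int c \<in> I 1" using x by (rule ring_residue)
  obtain d where d: "y - of_int d \<in> I 1" using y by (rule ring_residue)
  have "of_int (c * d) = x * y + (x * (-1) * (y - of_int d) + of_int (- d) * (x - of_int c))"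
    by (simp add: algebra_simps)
  also have "\<dots> \<in> I 1" using x ring_of_int[of "-1"]
    by (intro id(3)[OF xy] id(3)[OF id(4)[OF _ d] id(4)[OF _ c]] ring_mult ring_of_int) simp_all
  finally have "int p dvd c * d" by (rule of_int_mem_I_1)
  then have "int p dvd c \<or> int p dvd d" using p by (simp add: prime_dvd_mult_iff)
  moreover have "of_int k \<in> I 1" if "int p dvd k" for k
  proof -
    obtain l where "k = l * int p" using \<open>int p dvd k\<close> by (metis dvdE mult.commute)
    then have "of_int k = of_int l * (of_nat p :: complex)" by simp
    then show ?thesis using id(4)[OF ring_of_int p_mem_I_1] by simp
  qed
  ultimately show "x \<in> I 1 \<or> y \<in> I 1"
    using id(3)[OF c, of "of_int c"] id(3)[OF d, of "of_int d"] by auto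
qed

text \<open>If they agreed, the ideal would contain \<open>\<alpha> + cnj \<alpha> = t\<close>,
  which \<open>p\<close> does not divide.\<close>

lemma I_1_neq_cnj: "I 1 \<noteq> split_prime.I D p (cnj \<alpha>) 1"
proof
  assume "I 1 = split_prime.I D p (cnj \<alpha>) 1"
  then have "cnj \<alpha> \<in> I 1" by (simp add: split_prime.I_def[OF cnj_split_prime] ideal2_mem)
  moreover have "\<alpha> \<in> I 1" by (simp add: I_def ideal2_mem)
  ultimately have "of_int t \<in> I 1" using is_idealD(3)[OF is_ideal_I] tr by metis
  then have "int p dvd t" by (rule of_int_mem_I_1)
  then have "is_unit (int p)" using coprime_common_divisor[OF cop _ dvd_refl] by blast
  then show False using p by auto
qed

section \<open>From a smaller order to a root of the generator\<close>

lemma \<alpha>_neq_0: "\<alpha> \<noteq> 0"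
  using nm p by auto

lemma I_power_principal:
  assumes "I j = principal_ideal R \<gamma>" "j \<le> n" "\<gamma> \<in> R"
  shows "m * j \<le> n \<Longrightarrow> I (m * j) = principal_ideal R (\<gamma> ^ m)"
proof (induction m)
  case 0
  then show ?case by (auto simp: I_0 principal_ideal_def)
next
  case (Suc m)
  then show ?case using I_mult[of j "m * j"] assms principal_mult[of \<gamma> "\<gamma> ^ m"]
    by (simp add: ring_power)
qed

text \<open>The exponents of the principal powers of \<open>I 1\<close> are the multiples of the least one.\<close>
lemma least_principal_exponent:
  assumes "\<not> has_class_order R (I 1) n"
  obtains m \<beta> where "m dvd n" "0 < m" "m < n" "\<beta> \<in> R" "I m = principal_ideal R \<beta>"
proof -
  define m where "m = (LEAST m. 0 < m \<and> is_principal R (I m))"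
  have prn: "is_principal R (I n)" using I_n \<alpha> by (auto simp: is_principal_def)
  obtain l where l: "0 < l" "l < n" "is_principal R (I l)"
    using assms n prn by (auto simp: has_class_order_def ideal_pow_I[unfolded One_nat_def])
  have m: "0 < m" "is_principal R (I m)" and ml: "m \<le> l"
    using LeastI[of "\<lambda>m. 0 < m \<and> is_principal R (I m)" l] l 
      Least_le[of "\<lambda>m. 0 < m \<and> is_principal R (I m)" l] by (auto simp: m_def)
  have least: "\<not> is_principal R (I s)" if "0 < s" "s < m" for s
    using not_less_Least[of s "\<lambda>m. 0 < m \<and> is_principal R (I m)"] that by (auto simp: m_def)
  obtain \<beta> where \<beta>: "\<beta> \<in> R" "I m = principal_ideal R \<beta>" using m by (auto simp: is_principal_def)
  define k s where "k = n div m" and "s = n mod m"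
  have nks: "n = k * m + s" by (simp add: k_def s_def)
  have "s = 0"
  proof (rule ccontr)
    assume s0: "s \<noteq> 0"
    \<comment> \<open>Here \<open>(\<alpha>) = I (k * m) * I s = b * I s\<close>; cancelling
      \<open>b\<close> makes \<open>I s\<close> principal with \<open>0 < s < m\<close>, against the
      choice of \<open>m\<close>.\<close>
    define b where "b = \<beta> ^ k"
    have b: "b \<in> R" by (simp add: b_def \<beta> ring_power)
    have "I (k * m) = principal_ideal R b"
      unfolding b_def using I_power_principal[OF \<beta>(2) _ \<beta>(1)] ml l nks by simp
    then have *: "principal_ideal R \<alpha> = ideal2 (b * of_nat (p ^ s)) (b * \<alpha>)"
      using I_mult[of "k * m" s] nks I_n ideal_mult_principal[OF b ring_of_nat \<alpha>]
      by (simp add: I_def del: of_nat_power)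
    have scale: "ideal2 (b * of_nat (p ^ s)) (b * \<alpha>) = (\<lambda>z. b * z) ` I s"
    proof (intro set_eqI iffI)
      fix z assume "z \<in> ideal2 (b * of_nat (p ^ s)) (b * \<alpha>)"
      then obtain x y where xy: "z = b * of_nat (p ^ s) * x + b * \<alpha> * y" "x \<in> R" "y \<in> R" by (rule ideal2E)
      then have "z = b * (of_nat (p ^ s) * x + \<alpha> * y)" by (simp add: algebra_simps)
      then show "z \<in> (\<lambda>z. b * z) ` I s" unfolding I_def using ideal2I[OF refl xy(2,3)] by (rule image_eqI)
    next
      fix z assume "z \<in> (\<lambda>z. b * z) ` I s"
      then obtain x y where xy: "z = b * (of_nat (p ^ s) * x + \<alpha> * y)" "x \<in> R" "y \<in> R"
        unfolding I_def by (elim imageE ideal2E) blast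
      then have "z = b * of_nat (p ^ s) * x + b * \<alpha> * y" by (simp add: algebra_simps)
      then show "z \<in> ideal2 (b * of_nat (p ^ s)) (b * \<alpha>)" using xy(2,3) by (rule ideal2I)
    qed
    have "\<alpha> \<in> principal_ideal R \<alpha>" unfolding ideal2_0[symmetric] by (rule ideal2_mem)
    then obtain d where d: "d \<in> I s" "\<alpha> = b * d" using * scale by auto
    have b0: "b \<noteq> 0" using d \<alpha>_neq_0 by auto
    have dR: "d \<in> R" using d is_idealD[OF is_ideal_I] by blast
    have "I s = principal_ideal R d"
    proof
      show "I s \<subseteq> principal_ideal R d"
      proof
        fix z assume "z \<in> I s"
        then have "b * z \<in> principal_ideal R \<alpha>" using * scale by auto
        then obtain r where "b * z = b * d * r" "r \<in> R" using d by (auto simp: principal_ideal_def)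
        then show "z \<in> principal_ideal R d" using b0 by (auto simp: principal_ideal_def)
      qed
      show "principal_ideal R d \<subseteq> I s" using is_idealD(5)[OF is_ideal_I _ d(1)]
        by (auto simp: principal_ideal_def)
    qed
    then have "is_principal R (I s)" using dR by (auto simp: is_principal_def)
    then show False using least[of s] s0 m by (simp add: s_def)
  qed
  then have "m dvd n" using nks by simp
  then show ?thesis using that m \<beta> ml l by auto
qed

text \<open>Let \<open>I m = (\<beta>)\<close> with \<open>m\<close> a proper divisor of
  \<open>n\<close>, and \<open>r\<close> a prime factor of \<open>k = n / m\<close>. Then
  \<open>\<gamma> = \<beta> ^ (k / r)\<close> has \<open>(\<gamma> ^ r) = I n = (\<alpha>)\<close>,
  and two generators differ by a unit.\<close>

lemma principal_power_root:
  assumes "\<not> has_class_order R (I 1) n"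
  obtains r j \<gamma> u where "prime r" "n = r * j" "\<gamma> \<in> R" "\<gamma> * cnj \<gamma> = of_int (int (p ^ j))"
    "u \<in> R" "u * cnj u = 1" "\<gamma> ^ r = u * \<alpha>"
proof -
  obtain m \<beta> where m: "m dvd n" "0 < m" "m < n" and \<beta>: "\<beta> \<in> R" "I m = principal_ideal R \<beta>"
    by (rule least_principal_exponent[OF assms])
  obtain k where k: "n = m * k" using m by blast
  then have "k \<noteq> 1" using m by auto
  then obtain r where r: "prime r" "r dvd k" using prime_factor_nat by blast
  then obtain k' where k': "k = r * k'" by blast
  define j \<gamma> where "j = m * k'" and "\<gamma> = \<beta> ^ k'"
  have nrj: "n = r * j" by (simp add: k k' j_def)
  have \<gamma>: "\<gamma> \<in> R" by (simp add: \<gamma>_def \<beta> ring_power)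
  have "I n = principal_ideal R (\<beta> ^ k)"
    using I_power_principal[OF \<beta>(2) _ \<beta>(1), of k] m k by (simp add: mult.commute)
  then have eq: "principal_ideal R \<alpha> = principal_ideal R (\<gamma> ^ r)"
    using I_n k' by (simp add: \<gamma>_def power_mult mult.commute)
  have self: "a \<in> principal_ideal R a" for a unfolding ideal2_0[symmetric] by (rule ideal2_mem)
  obtain u where u: "\<gamma> ^ r = u * \<alpha>" "u \<in> R"
    using self[of "\<gamma> ^ r"] unfolding eq[symmetric] by (auto simp: principal_ideal_def mult.commute)
  obtain v where v: "\<alpha> = v * \<gamma> ^ r" "v \<in> R"
    using self[of \<alpha>] unfolding eq by (auto simp: principal_ideal_def mult.commute)
  have "u * v = 1" using u v \<alpha>_neq_0 by (metis mult.assoc mult.commute mult_cancel_right1)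
  \<comment> \<open>Norms are moved to the naturals, where \<open>nu * nv = 1\<close> leaves only 1
    and \<open>r\<close>-th roots are unique.\<close>
  have norm: "\<exists>b::nat. z * cnj z = of_nat b" if "z \<in> R" for z
  proof -
    obtain b where b: "z * cnj z = of_int b" using \<open>z \<in> R\<close> by (rule ring_normE)
    have "Re (z * cnj z) \<ge> 0" by simp
    then have "b \<ge> 0" unfolding b by simp
    then have "z * cnj z = of_nat (nat b)" using b by simp
    then show ?thesis by blast
  qed
  obtain nu where nu: "u * cnj u = of_nat nu" using norm u by blast
  obtain nv where nv: "v * cnj v = of_nat nv" using norm v by blast
  obtain ng where ng: "\<gamma> * cnj \<gamma> = of_nat ng" using norm \<gamma> by blast
  have "of_nat (nu * nv) = (u * v) * cnj (u * v)" using nu nv by (simp add: mult_ac)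
  also have "\<dots> = of_nat 1" by (simp add: \<open>u * v = 1\<close>)
  finally have "nu = 1" by (simp only: of_nat_eq_iff) simp
  then have u1: "u * cnj u = 1" using nu by simp
  have "of_nat (ng ^ r) = (\<gamma> ^ r) * cnj (\<gamma> ^ r)" by (simp add: ng[symmetric] power_mult_distrib)
  also have "\<dots> = (u * cnj u) * (\<alpha> * cnj \<alpha>)" by (simp add: u mult_ac)
  also have "\<dots> = of_nat (p ^ n)" by (simp only: u1 nm) simp
  finally have "ng ^ r = p ^ n" by (simp only: of_nat_eq_iff)
  then have "ng ^ r = (p ^ j) ^ r" by (simp add: nrj power_mult[symmetric] mult.commute)
  then have "ng = p ^ j" using r by (metis power_eq_iff_eq_base prime_gt_0_nat zero_le)
  then show ?thesis using that[OF r(1) nrj \<gamma> _ u(2) u1 u(1)] ng by simp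
qed

text \<open>A unit \<open>u\<close> with \<open>u\<^sup>2 = \<plusminus>1\<close> or \<open>u ^ 3 = \<plusminus>1\<close> is, up to sign, an \<open>r\<close>-th power unless \<open>r\<close> is
  2 or 3 respectively; so \<open>\<alpha>\<close> is \<open>\<plusminus>\<close> an \<open>r\<close>-th power.\<close>
lemma lucas_V_if_not_order:
  assumes "\<not> has_class_order R (I 1) n"
  shows "\<exists>r j. prime r \<and> n = r * j \<and> ((\<exists>c. \<bar>lucas_V c (int p ^ j) r\<bar> = \<bar>t\<bar>) 
    \<or> r = 2 \<and> (\<exists>f. D = - (f\<^sup>2)) \<or> r = 3 \<and> (\<exists>f. D = - 3 * f\<^sup>2))"
proof -
  obtain r j \<gamma> u where r: "prime r" "n = r * j" and \<gamma>: "\<gamma> \<in> R" "\<gamma> * cnj \<gamma> = of_int (int (p ^ j))"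
    and u: "u \<in> R" "u * cnj u = 1" and eq: "\<gamma> ^ r = u * \<alpha>"
    by (rule principal_power_root[OF assms])
  \<comment> \<open>A unit \<open>v\<close> with \<open>u * v ^ r\<close> equal to 1 or -1 absorbs
    \<open>u\<close>: \<open>\<gamma> * v\<close> keeps its norm and its \<open>r\<close>-th power
    is \<open>\<alpha>\<close> up to sign.\<close>
  have main: "\<exists>c. \<bar>lucas_V c (int p ^ j) r\<bar> = \<bar>t\<bar>" if v: "v \<in> R" "v * cnj v = 1" and uv: "u * v ^ r = 1 \<or> u * v ^ r = -1" for v
  proof -
    define g where "g = \<gamma> * v"
    have g: "g \<in> R" by (simp add: g_def \<gamma> v ring_mult)
    have "g * cnj g = (\<gamma> * cnj \<gamma>) * (v * cnj v)" by (simp add: g_def mult_ac)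
    then have ng: "g * cnj g = of_int (int p ^ j)" using \<gamma> v by simp
    obtain c where c: "g + cnj g = of_int c" using g by (auto elim: ring_traceE)
    have "g ^ r = (u * v ^ r) * \<alpha>" by (simp add: g_def power_mult_distrib eq mult_ac)
    then have "g ^ r = \<alpha> \<or> g ^ r = - \<alpha>" using uv by auto
    then have "g ^ r + cnj (g ^ r) = of_int t \<or> g ^ r + cnj (g ^ r) = of_int (- t)"
    proof
      assume "g ^ r = - \<alpha>"
      then have "g ^ r + cnj (g ^ r) = - (\<alpha> + cnj \<alpha>)" by (simp del: complex_cnj_power)
      then have "g ^ r + cnj (g ^ r) = of_int (- t)" by (simp only: tr of_int_minus)
      then show ?thesis ..
    qed (simp add: tr del: complex_cnj_power)
    moreover have "g ^ r + cnj (g ^ r) = of_int (lucas_V c (int p ^ j) r)"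
      using lucas_V_power_sum[OF c ng] by simp
    ultimately have "lucas_V c (int p ^ j) r = t \<or> lucas_V c (int p ^ j) r = - t"
      by (simp only: of_int_eq_iff)
    then have "\<bar>lucas_V c (int p ^ j) r\<bar> = \<bar>t\<bar>" by auto
    then show ?thesis by blast
  qed
  consider "u = 1 \<or> u = -1" | "u\<^sup>2 = -1" "\<exists>f. D = - (f\<^sup>2)" | "u ^ 3 = 1 \<or> u ^ 3 = -1" "\<exists>f. D = - 3 * f\<^sup>2"
    using unit_cases[OF u] by blast
  then show ?thesis
  proof cases
    case 1
    then have "\<exists>c. \<bar>lucas_V c (int p ^ j) r\<bar> = \<bar>t\<bar>" by (intro main[of 1]) auto
    then show ?thesis using r by blast
  next
    case 2
    show ?thesis
    proof (cases "r = 2")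
      case False
      then have "odd r" using r(1) prime_odd_nat prime_ge_2_nat[of r] by force
      then obtain i where i: "r = 2 * i + 1" by (rule oddE)
      \<comment> \<open>For odd \<open>r\<close> the choice \<open>v = u\<close> works, because
        \<open>1 + r\<close> is even.\<close>
      have "u * u ^ r = (u\<^sup>2) ^ (i + 1)" unfolding i
        by (simp add: power_mult power_add mult_ac) (simp add: power2_eq_square power_mult_distrib)
      then have "u * u ^ r = 1 \<or> u * u ^ r = -1" unfolding 2 by (cases "even i") auto
      then show ?thesis using main[of u] u r by blast
    qed (use 2 r in blast)
  next
    case 3
    show ?thesis
    proof (cases "r = 3")
      case False
      then have "\<not> 3 dvd r" using r(1) primes_dvd_imp_eq[of 3 r] by auto
      \<comment> \<open>The exponent \<open>e\<close> is chosen so that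
        \<open>u * (u ^ e) ^ r\<close> is a power of \<open>u ^ 3\<close>.\<close>
      then obtain v e i where ve: "v = u ^ e" "1 + e * r = 3 * i"
      proof -
        assume *: "\<And>v e i. v = u ^ e \<Longrightarrow> 1 + e * r = 3 * i \<Longrightarrow> thesis"
        have "r mod 3 = 1 \<or> r mod 3 = 2" using \<open>\<not> 3 dvd r\<close> by presburger
        then show thesis
        proof
          assume "r mod 3 = 1" then have "1 + 2 * r = 3 * ((1 + 2 * r) div 3)" by presburger
          then show ?thesis using *[OF refl] by blast
        next
          assume "r mod 3 = 2" then have "1 + 1 * r = 3 * ((1 + 1 * r) div 3)" by presburger
          then show ?thesis using *[OF refl] by blast
        qed
      qed
      have "u * v ^ r = (u ^ 3) ^ i" unfolding ve(1) power_mult[symmetric] ve(2)[symmetric] by (simp add: power_add)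
      then have *: "u * v ^ r = 1 \<or> u * v ^ r = -1" using 3 by (cases "even i") auto
      have "v * cnj v = (u * cnj u) ^ e" by (simp add: ve power_mult_distrib)
      then have "v * cnj v = 1" using u by simp
      moreover have "v \<in> R" using u by (simp add: ve ring_power)
      ultimately show ?thesis using main[of v] * r by blast
    qed (use 3 r in blast)
  qed
qed

text \<open>\<open>I 1\<close> and its conjugate are always distinct primes with product
  \<open>(p)\<close>, so one of the two orders must fail. As \<open>cnj \<alpha>\<close> has the
  same trace and norm, either failure yields the same alternatives.\<close>

lemma lucas_V_if_not_splits:
  assumes "\<not> splits_with_order D p n"
  shows "\<exists>r j. prime r \<and> n = r * j \<and> ((\<exists>c. \<bar>lucas_V c (int p ^ j) r\<bar> = \<bar>t\<bar>) 
    \<or> r = 2 \<and> (\<exists>f. D = - (f\<^sup>2)) \<or> r = 3 \<and> (\<exists>f. D = - 3 * f\<^sup>2))"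
proof -
  interpret cnj: split_prime D p n t "cnj \<alpha>" by (rule cnj_split_prime)
  have "\<not> (has_class_order R (I 1) n \<and> has_class_order R (cnj.I 1) n)"
    using assms prime_ideal_I_1 cnj.prime_ideal_I_1 I_1_neq_cnj I_1_mult_cnj
    unfolding splits_with_order_def Let_def by blast
  then show ?thesis using lucas_V_if_not_order cnj.lucas_V_if_not_order by blast
qed

end

subsection \<open>Lucas sequences at prime indices\<close>

text \<open>This bounds \<open>c\<close>: when the value is 1 or 2 up to sign, few divisors
  remain.\<close>

lemma lucas_V_dvd: "odd k \<Longrightarrow> c dvd lucas_V c q k"
proof (induction k rule: induct_nat_012)
  case (ge2 k)
  then show ?case by (simp add: dvd_diff)
qed auto

lemma lucas_V_minus: "lucas_V (- c) q k = (- 1) ^ k * lucas_V c q k"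
  by (induction k rule: induct_nat_012) (simp_all add: algebra_simps)

lemma abs_lucas_V_minus: "\<bar>lucas_V (- c) q k\<bar> = \<bar>lucas_V c q k\<bar>"
  by (simp add: lucas_V_minus abs_mult power_abs)

text \<open>The start of the expansion in powers of \<open>q\<close>. The index is shifted because
  the formula does not fit the value 1 at index 1.\<close>

lemma lucas_V_1_mod_square:
  "\<exists>m. lucas_V 1 q (k + 2) = 1 - int (k + 2) * q + q\<^sup>2 * m"
proof (induction k rule: induct_nat_012)
  case 0
  show ?case by (auto simp: numeral_2_eq_2)
next
  case 1
  show ?case by (rule exI[of _ 0]) (simp add: numeral_2_eq_2)
next
  case (ge2 k)
  then obtain m m' where
    m: "lucas_V 1 q (k + 2) = 1 - int (k + 2) * q + q\<^sup>2 * m"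
    "lucas_V 1 q (Suc k + 2) = 1 - int (Suc k + 2) * q + q\<^sup>2 * m'" by blast
  have "lucas_V 1 q (Suc (Suc k) + 2) = lucas_V 1 q (Suc k + 2) - q * lucas_V 1 q (k + 2)" by simp
  also have "\<dots> = 1 - int (Suc (Suc k) + 2) * q + q\<^sup>2 * (m' + int (k + 2) - q * m)"
    unfolding m by (simp add: algebra_simps power2_eq_square)
  finally show ?case by blast
qed

text \<open>One more term of that expansion, fitting from index 3 on; doubling avoids the half in
  the coefficient of \<open>q ^ 2\<close>.\<close>

lemma lucas_V_1_mod_cube:
  "\<exists>m. 2 * lucas_V 1 q (k + 3) = 2 - 2 * int (k + 3) * q + int (k + 3) * int k * q\<^sup>2 + q ^ 3 * m"
proof (induction k rule: induct_nat_012)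
  case 0
  show ?case by (rule exI[of _ 0]) (simp add: eval_nat_numeral)
next
  case 1
  show ?case by (rule exI[of _ 0]) (simp add: eval_nat_numeral algebra_simps)
next
  case (ge2 k)
  then obtain m m' where
    m: "2 * lucas_V 1 q (k + 3) = 2 - 2 * int (k + 3) * q + int (k + 3) * int k * q\<^sup>2 + q ^ 3 * m"
    "2 * lucas_V 1 q (Suc k + 3) = 2 - 2 * int (Suc k + 3) * q + int (Suc k + 3) * int (Suc k) * q\<^sup>2 + q ^ 3 * m'"
    by blast
  have "lucas_V 1 q (Suc (Suc k) + 3) = lucas_V 1 q (Suc k + 3) - q * lucas_V 1 q (k + 3)"
    by (simp only: add_Suc lucas_V.simps mult_1)
  then have "2 * lucas_V 1 q (Suc (Suc k) + 3) = 2 * lucas_V 1 q (Suc k + 3) - q * (2 * lucas_V 1 q (k + 3))"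
    by (simp only: right_diff_distrib mult.left_commute)
  also have "\<dots> = 2 - 2 * int (Suc (Suc k) + 3) * q + int (Suc (Suc k) + 3) * int (Suc (Suc k)) * q\<^sup>2
      + q ^ 3 * (m' - int (k + 3) * int k - q * m)"
    unfolding m by (simp add: algebra_simps power2_eq_square power3_eq_cube)
  finally show ?case by blast
qed

text \<open>The residues modulo 7 repeat as 2, 1, 4, so the value -1 never occurs.\<close>

lemma lucas_V_1_2_mod_7: "\<exists>m. lucas_V 1 2 k = 7 * m + 2 \<and> (\<exists>m. lucas_V 1 2 (Suc k) = 7 * m + 1)
    \<or> lucas_V 1 2 k = 7 * m + 1 \<and> (\<exists>m. lucas_V 1 2 (Suc k) = 7 * m + 4)
    \<or> lucas_V 1 2 k = 7 * m + 4 \<and> (\<exists>m. lucas_V 1 2 (Suc k) = 7 * m + 2)"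
proof (induction k)
  case (Suc k)
  have *: "lucas_V 1 2 (Suc (Suc k)) = lucas_V 1 2 (Suc k) - 2 * lucas_V 1 2 k" by simp
  show ?case using Suc unfolding * by presburger
qed auto

text \<open>Modulo 2 the recurrence is that of Fibonacci, with the pattern even, odd, odd.\<close>

lemma lucas_V_parity:
  assumes "odd q"
  shows "even (lucas_V 1 q k) \<longleftrightarrow> 3 dvd k"
proof -
  have "(even (lucas_V 1 q k) \<longleftrightarrow> 3 dvd k) \<and> (even (lucas_V 1 q (Suc k)) \<longleftrightarrow> 3 dvd Suc k)"
  proof (induction k)
    case (Suc k)
    have "even (lucas_V 1 q (Suc (Suc k))) \<longleftrightarrow> (even (lucas_V 1 q (Suc k)) \<longleftrightarrow> even (lucas_V 1 q k))"
      using assms by simp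
    then show ?case using Suc by presburger
  qed simp
  then show ?thesis ..
qed

text \<open>Divisibility by \<open>c\<close> reduces to \<open>c = 1\<close>. The value 1 gives
  \<open>q dvd r\<close> modulo \<open>q ^ 2\<close>, so \<open>q = r\<close>, and then
  \<open>q dvd 2\<close> modulo \<open>q ^ 3\<close>, against \<open>r \<ge> 3\<close>. The value -1
  gives \<open>q = 2\<close>, which residues modulo 7 exclude.\<close>

lemma abs_lucas_V_neq_1:
  assumes r: "prime r" "odd r" and q: "2 \<le> q"
  shows "\<bar>lucas_V c q r\<bar> \<noteq> 1"
proof
  assume V: "\<bar>lucas_V c q r\<bar> = 1"
  have r3: "r \<ge> 3" using r prime_ge_2_nat[of r] by (cases "r = 2") auto
  have "c dvd lucas_V c q r" using r by (intro lucas_V_dvd)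
  then have "is_unit c" using V by (metis abs_dvd_iff dvd_abs_iff)
  then have "c = 1 \<or> c = -1" by auto
  then have V1: "\<bar>lucas_V 1 q r\<bar> = 1" using V abs_lucas_V_minus[of 1 q r] by auto
  obtain m where m: "lucas_V 1 q r = 1 - int r * q + q\<^sup>2 * m"
    using lucas_V_1_mod_square[of q "r - 2"] r3 by (metis le_add_diff_inverse2 le_trans eval_nat_numeral(3) le_SucI order_refl)
  show False
  proof (cases "lucas_V 1 q r = 1")
    case True
    then have "int r * q = q\<^sup>2 * m" using m by linarith
    then have "q * int r = q * (q * m)" by (simp add: power2_eq_square mult_ac)
    then have rq: "int r = q * m" using q by simp
    then have "q dvd int r" by simp
    moreover have "prime (int r)" "0 \<le> q" using r q by simp_all
    ultimately have "q = 1 \<or> q = int r" unfolding prime_int_iff by blast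
    then have qr: "q = int r" using q by simp
    obtain k where k: "r = k + 3" using r3 by (metis le_Suc_ex add.commute)
    obtain m where "2 * lucas_V 1 q r = 2 - 2 * int r * q + int r * int k * q\<^sup>2 + q ^ 3 * m"
      using lucas_V_1_mod_cube[of q k] k by auto
    then have "2 * q\<^sup>2 = q\<^sup>2 * (q * (int k + m))"
      using True by (simp add: qr power2_eq_square power3_eq_cube algebra_simps)
    then have "2 = q * (int k + m)" using q by simp
    then have "q dvd 2" by (rule dvdI)
    then have "q \<le> 2" by (simp add: zdvd_imp_le)
    then show False using qr r3 by simp
  next
    case False
    then have V: "lucas_V 1 q r = -1" using V1 by linarith
    then have "2 = q * (int r - q * m)" using m by (simp add: power2_eq_square algebra_simps)
    then have "q dvd 2" by (rule dvdI)
    then have "q = 2" using q zdvd_imp_le by force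
    then show False using V lucas_V_1_2_mod_7[of r] by auto presburger+
  qed
qed

section \<open>The Lucas sequence with first parameter 2, by binomial expansion\<close>

lemma sum_even_odd_split:
  "(\<Sum>i<2 * m. f i) = (\<Sum>j<m. f (2 * j) + f (2 * j + 1 :: nat) :: 'a :: comm_monoid_add)"
  by (induction m) (simp_all add: add.assoc)

text \<open>The roots in question are \<open>1 + w\<close> and \<open>1 - w\<close> with
  \<open>w ^ 2 = d\<close>; odd powers of \<open>w\<close> cancel in the sum.\<close>

lemma lucas_V_2_binomial:
  "lucas_V 2 (1 - d) k = 2 * (\<Sum>j\<le>k. int (k choose (2 * j)) * d ^ j)"
proof -
  define w where "w = csqrt (of_int d)"
  have w: "w ^ 2 = of_int d" by (simp add: w_def)
  have "(1 + w) * (1 - w) = 1 - w ^ 2" by (simp add: power2_eq_square algebra_simps)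
  then have nm: "(1 + w) * (1 - w) = of_int (1 - d)" by (simp add: w)
  have tr: "(1 + w) + (1 - w) = of_int 2" by simp
  \<comment> \<open>The sum is continued beyond \<open>k\<close> with vanishing binomials, so that
    its terms pair up evenly.\<close>
  have binom: "(1 + z) ^ k = (\<Sum>i<2 * Suc k. of_nat (k choose i) * z ^ i)" for z :: complex
  proof -
    have "(1 + z) ^ k = (z + 1) ^ k" by (simp add: add.commute)
    also have "\<dots> = (\<Sum>i\<le>k. of_nat (k choose i) * z ^ i)" by (simp add: binomial_ring)
    also have "\<dots> = (\<Sum>i<2 * Suc k. of_nat (k choose i) * z ^ i)"
      by (rule sum.mono_neutral_left) auto
    finally show ?thesis .
  qed
  have "of_int (lucas_V 2 (1 - d) k) = (1 + w) ^ k + (1 + (- w)) ^ k"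
    using lucas_V_power_sum[OF tr nm, of k] by simp
  also have "\<dots> = (\<Sum>i<2 * Suc k. of_nat (k choose i) * w ^ i + of_nat (k choose i) * (- w) ^ i)"
    unfolding binom sum.distrib ..
  also have "\<dots> = (\<Sum>j<Suc k. 2 * (of_nat (k choose (2 * j)) * (w ^ 2) ^ j))"
    unfolding sum_even_odd_split by (intro sum.cong) (simp_all add: power_mult)
  also have "\<dots> = of_int (2 * (\<Sum>j\<le>k. int (k choose (2 * j)) * d ^ j))"
    unfolding w by (simp add: sum_distrib_left lessThan_Suc_atMost)
  finally show ?thesis by (simp only: of_int_eq_iff)
qed

lemma prime_power_dvd_coprime_mult:
  fixes s :: int
  assumes "prime s" "coprime a b" "s ^ v dvd a * b"
  shows "s ^ v dvd a \<or> s ^ v dvd b"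
proof (cases "s dvd a")
  case True
  then have "\<not> s dvd b" using assms coprime_common_divisor not_prime_unit by blast
  then have "coprime (s ^ v) b" using assms by (simp add: prime_imp_coprime)
  then show ?thesis using assms by (simp add: coprime_dvd_mult_left_iff)
next
  case False
  then have "coprime (s ^ v) a" using assms by (simp add: prime_imp_coprime)
  then show ?thesis using assms by (simp add: coprime_dvd_mult_right_iff)
qed

text \<open>Comparing valuations at \<open>s\<close>: the term \<open>(k choose 2) * d\<close> of the binomial expansion
  has smaller valuation than all later ones, because \<open>(k choose 2j) j (2j - 1)\<close> is a multiple of \<open>k choose 2\<close>.\<close>
lemma binomial_term_dvd:
  fixes s d :: int
  assumes s: "prime s" and sd: "s\<^sup>2 dvd d" and d: "d \<noteq> 0" and k: "2 \<le> k" and j: "2 \<le> j"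
  shows "s ^ Suc (multiplicity s (int (k choose 2) * d)) dvd int (k choose (2 * j)) * d ^ j"
proof (cases "2 * j \<le> k")
  case False
  then show ?thesis by (simp add: binomial_eq_0)
next
  case True
  define x where "x = int (k choose (2 * j))"
  define y where "y = int j * (2 * int j - 1)"
  define v where "v = multiplicity s y"
  have pe: "prime_elem s" using s by (rule prime_imp_prime_elem)
  have nu: "\<not> is_unit s" using s not_prime_unit by blast
  have c0: "k choose 2 \<noteq> 0" using k by simp
  have x0: "x \<noteq> 0" using True by (simp add: x_def)
  have y0: "y \<noteq> 0" using j by (simp add: y_def)
  have "(2 * j) choose 2 = j * (2 * j - 1)" by (simp add: choose_two)
  then have "int ((2 * j) choose 2) = y" using j by (simp add: y_def of_nat_diff)
  then have "x * y = int (k choose 2) * int ((k - 2) choose (2 * j - 2))"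
    unfolding x_def using choose_mult[of 2 "2 * j" k] True j by (metis of_nat_mult le_trans mult_2 le_add1)
  then have "int (k choose 2) dvd x * y" by simp
  then have "multiplicity s (int (k choose 2)) \<le> multiplicity s (x * y)"
    by (rule dvd_imp_multiplicity_le) (simp add: x0 y0)
  also have "\<dots> = multiplicity s x + v"
    using prime_elem_multiplicity_mult_distrib[OF pe x0 y0] by (simp add: v_def)
  finally have 1: "multiplicity s (int (k choose 2)) \<le> multiplicity s x + v" .
  \<comment> \<open>By coprimality \<open>s ^ v\<close> divides a single factor of \<open>y\<close>,
    so \<open>s ^ v < 2 * j\<close> and \<open>v < 2 * j - 2\<close>. The \<open>j - 1\<close>
    additional factors \<open>d\<close>, each of valuation at least 2, outweigh this loss.\<close>
  have "coprime (int j) (2 * int j - 1)"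
  proof (rule coprimeI)
    fix c assume "c dvd int j" "c dvd 2 * int j - 1"
    then have "c dvd 2 * int j - (2 * int j - 1)" by (meson dvd_diff dvd_mult)
    then show "is_unit c" by simp
  qed
  moreover have "s ^ v dvd int j * (2 * int j - 1)" using multiplicity_dvd[of s y] by (simp add: v_def y_def)
  ultimately have "s ^ v dvd int j \<or> s ^ v dvd 2 * int j - 1"
    using prime_power_dvd_coprime_mult s by blast
  then have "s ^ v \<le> 2 * int j - 1"
    using j zdvd_imp_le[of "s ^ v" "int j"] zdvd_imp_le[of "s ^ v" "2 * int j - 1"] by auto
  moreover have "2 ^ v \<le> s ^ v" using s by (intro power_mono) (auto simp: prime_ge_2_int)
  ultimately have "(2::int) ^ v < int (2 * j)" by simp
  also have "int (2 * j) \<le> int (2 ^ (2 * j - 2))"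
  proof -
    have "2 * (i + 2) \<le> 2 ^ (2 * (i + 2) - 2)" for i :: nat
      by (induction i) auto
    from this[of "j - 2"] show ?thesis using j by (simp only: le_add_diff_inverse2 of_nat_le_iff)
  qed
  finally have "(2::int) ^ v < 2 ^ (2 * j - 2)" by simp
  then have v: "v < 2 * j - 2" by simp
  have d2: "multiplicity s d \<ge> 2" using sd d nu by (intro multiplicity_geI) auto
  have "Suc (multiplicity s (int (k choose 2) * d)) = Suc (multiplicity s (int (k choose 2)) + multiplicity s d)"
    using prime_elem_multiplicity_mult_distrib[OF pe _ d, of "int (k choose 2)"] c0 by simp
  also have "\<dots> \<le> multiplicity s x + v + 1 + multiplicity s d" using 1 by simp
  also have "\<dots> \<le> multiplicity s x + (j - 1) * 2 + multiplicity s d" using v by simp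
  also have "\<dots> \<le> multiplicity s x + (j - 1) * multiplicity s d + multiplicity s d"
    using d2 by simp
  also have "\<dots> = multiplicity s x + j * multiplicity s d" using j by (cases j) auto
  also have "\<dots> = multiplicity s (x * d ^ j)"
    using prime_elem_multiplicity_mult_distrib[OF pe x0, of "d ^ j"] d
      prime_elem_multiplicity_power_distrib[OF pe d] by simp
  finally show ?thesis unfolding x_def by (rule multiplicity_dvd')
qed

text \<open>Half the value is 1 plus \<open>(k choose 2) * d\<close> plus the tail \<open>B\<close>.
  The value 2 would make the last two cancel, but \<open>s\<close> divides \<open>B\<close> to a
  higher power; the value -2 would make \<open>s ^ 2\<close> divide 2.\<close>

lemma abs_lucas_V_2_neq_2:
  fixes s :: int
  assumes s: "prime s" and sd: "s\<^sup>2 dvd d" and d: "d \<noteq> 0" and k: "2 \<le> k"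
  shows "\<bar>lucas_V 2 (1 - d) k\<bar> \<noteq> 2"
proof
  assume V: "\<bar>lucas_V 2 (1 - d) k\<bar> = 2"
  define f where "f = (\<lambda>j. int (k choose (2 * j)) * d ^ j)"
  define B where "B = (\<Sum>j\<in>{2..k}. f j)"
  have "{..k} = insert 0 (insert 1 {2..k})" using k by auto
  then have A: "(\<Sum>j\<le>k. f j) = 1 + int (k choose 2) * d + B"
    by (simp add: f_def B_def)
  have "lucas_V 2 (1 - d) k = 2 * (1 + int (k choose 2) * d + B)"
    using lucas_V_2_binomial[of d k] A by (simp add: f_def)
  then have "int (k choose 2) * d + B = 0 \<or> int (k choose 2) * d + B = -2" using V by (auto simp: abs_if split: if_splits)
  then show False
  proof
    assume 1: "int (k choose 2) * d + B = 0"
    define e where "e = multiplicity s (int (k choose 2) * d)"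
    have "s ^ Suc e dvd B" unfolding B_def f_def e_def
      using binomial_term_dvd[OF s sd d k] by (intro dvd_sum) auto
    then have "s ^ Suc e dvd int (k choose 2) * d"
      using 1 by (metis dvd_add_left_iff dvd_0_right)
    moreover have "int (k choose 2) * d \<noteq> 0" using k d by simp
    ultimately have "Suc e \<le> e"
      unfolding e_def using s not_prime_unit by (subst (asm) power_dvd_iff_le_multiplicity) auto
    then show False by simp
  next
    assume 2: "int (k choose 2) * d + B = -2"
    have "d dvd B" unfolding B_def f_def by (intro dvd_sum dvd_mult dvd_power) auto
    then have "d dvd int (k choose 2) * d + B" by simp
    then have "s\<^sup>2 dvd - 2" using sd 2 dvd_trans by metis
    then have "s\<^sup>2 dvd 2" by simp
    then have "s\<^sup>2 \<le> 2" by (simp add: zdvd_imp_le)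
    moreover have "2\<^sup>2 \<le> s\<^sup>2" using s by (intro power_mono) (auto simp: prime_ge_2_int)
    ultimately show False by simp
  qed
qed

text \<open>Here \<open>c\<close> divides 2. For \<open>c\<close> odd, parity forces
  \<open>r = 3\<close>, where \<open>1 - 3 * q\<close> is too large in absolute value; for
  \<open>c\<close> even, \<open>abs_lucas_V_2_neq_2\<close> applies unless \<open>r = 3\<close>. The
  condition on \<open>q - 1\<close> excludes examples such as
  \<open>lucas_V 2 3 5 = 2\<close>.\<close>

lemma abs_lucas_V_neq_2:
  assumes r: "prime r" "odd r" and q: "1 < q" "odd q"
    and rs: "r = 3 \<or> (\<exists>s. prime s \<and> s\<^sup>2 dvd q - 1)"
  shows "\<bar>lucas_V c q r\<bar> \<noteq> 2"
proof
  assume V: "\<bar>lucas_V c q r\<bar> = 2"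
  have r3: "r \<ge> 3" using r prime_ge_2_nat[of r] by (cases "r = 2") auto
  have V3: "lucas_V c q 3 = c ^ 3 - 3 * c * q" for c
    by (simp add: eval_nat_numeral algebra_simps)
  have "c dvd lucas_V c q r" using r by (intro lucas_V_dvd)
  then have "c dvd 2" using V by (metis dvd_abs_iff)
  then have "\<bar>c\<bar> dvd 2" by simp
  then have "\<bar>c\<bar> \<le> 2" "c \<noteq> 0" using zdvd_imp_le by auto
  then have "c = 1 \<or> c = -1 \<or> c = 2 \<or> c = -2" by auto
  then consider "\<bar>lucas_V 1 q r\<bar> = 2" | "\<bar>lucas_V 2 q r\<bar> = 2"
    using V abs_lucas_V_minus[of 1 q r] abs_lucas_V_minus[of 2 q r] by auto
  then show False
  proof cases
    case 1
    then have "lucas_V 1 q r = 2 \<or> lucas_V 1 q r = -2" by linarith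
    then have "even (lucas_V 1 q r)" by auto
    then have "3 dvd r" using lucas_V_parity q by blast
    then have "r = 3" using r primes_dvd_imp_eq[of 3 r] by auto
    then show False using 1 q by (simp add: V3)
  next
    case 2
    show False
    proof (cases "r = 3")
      case True
      then show False using 2 q by (auto simp: V3 abs_if split: if_splits)
    next
      case False
      then obtain s where s: "prime s" "s\<^sup>2 dvd q - 1" using rs by blast
      then have "s\<^sup>2 dvd 1 - q" by (metis dvd_minus_iff minus_diff_eq)
      then show False using abs_lucas_V_2_neq_2[OF s(1), of "1 - q" r] 2 q r3 by simp
    qed
  qed
qed

text \<open>The prime 3 divides one factor; once it is removed, coprime numbers multiply to a
  square, so the other factor is a square.\<close>

lemma mult_eq_3_square:
  fixes a b g :: nat
  assumes "coprime a b" "a * b = 3 * g\<^sup>2" "a > 0" "b > 0"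
  obtains x where "a = x\<^sup>2" | x where "b = x\<^sup>2"
proof -
  have *: "\<exists>x. b = x\<^sup>2" if ab: "coprime a b" "a * b = 3 * g\<^sup>2" "a > 0" "b > 0" "3 dvd a" for a b
  proof -
    obtain a' where a': "a = 3 * a'" using ab by blast
    have "a' * b = g\<^sup>2" using ab a' by simp
    then have "is_nth_power 2 (a' * b)" by auto
    then have "is_nth_power 2 b" using is_nth_power_mult_coprime_natD(2)[of a' b 2] ab a' by simp
    then show ?thesis by (simp add: is_nth_power_def)
  qed
  have "3 dvd a * b" using assms by simp
  then have "3 dvd a \<or> 3 dvd b" using prime_dvd_mult_iff[of "3::nat"] by simp
  then show ?thesis using *[of a b] *[of b a] assms that by (auto simp: coprime_commute mult.commute)
qed

subsection \<open>Orders of the primes above \<open>p\<close>\<close>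

text \<open>The witness \<open>(t + s * w) / 2\<close> has trace \<open>t\<close> and, by the
  equation, norm \<open>p ^ n\<close>.\<close>

lemma split_prime_exists:
  fixes t s :: int
  assumes "D < 0" "prime p" "n > 0" "t\<^sup>2 - s\<^sup>2 * D = 4 * int p ^ n" "coprime t (int p)"
  shows "\<exists>\<alpha>. split_prime D p n t \<alpha>"
proof -
  interpret imag_quad D by unfold_locales fact
  define \<alpha> where "\<alpha> = (of_int t + of_int s * w) / 2"
  have tr: "\<alpha> + cnj \<alpha> = of_int t" by (simp add: \<alpha>_def field_simps)
  have "4 * (\<alpha> * cnj \<alpha>) = of_int t ^ 2 - of_int s ^ 2 * (w * w)"
    by (simp add: \<alpha>_def power2_eq_square field_simps)
  also have "\<dots> = of_int (t\<^sup>2 - s\<^sup>2 * D)" by (simp add: w_square)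
  also have "\<dots> = 4 * of_int (int p ^ n)" unfolding assms(4) by simp
  finally have nm: "\<alpha> * cnj \<alpha> = of_int (int p ^ n)" by simp
  have "\<alpha> = of_rat (of_int t / 2) + of_rat (of_int s / 2) * w"
    by (simp add: \<alpha>_def of_rat_divide add_divide_distrib)
  then have "\<alpha> \<in> quad_field D" by (rule quad_fieldI)
  then have "\<alpha> \<in> R" using tr nm by (rule ringI)
  then have "split_prime D p n t \<alpha>" using assms tr nm by unfold_locales simp_all
  then show ?thesis ..
qed

text \<open>The last two cases are the fields generated by the square roots of -1 and -3, whose
  further units resist absorption for \<open>r = 2\<close> and \<open>r = 3\<close>; of
  \<open>r\<close> only its dividing \<open>n\<close> is kept.\<close>

lemma not_splits_with_orderE:
  fixes t s :: int
  assumes "\<not> splits_with_order D p n"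
    and "D < 0" "prime p" "n > 0" "t\<^sup>2 - s\<^sup>2 * D = 4 * int p ^ n" "coprime t (int p)"
  obtains (lucas) r j c where "prime r" "n = r * j" "\<bar>lucas_V c (int p ^ j) r\<bar> = \<bar>t\<bar>"
  | (Gauss) f where "even n" "D = - (f\<^sup>2)"
  | (Eisenstein) f where "3 dvd n" "D = - 3 * f\<^sup>2"
proof -
  obtain \<alpha> where "split_prime D p n t \<alpha>" using split_prime_exists assms by blast
  then show ?thesis using split_prime.lucas_V_if_not_splits[OF _ assms(1)] that by (metis dvd_triv_left)
qed

section \<open>Congruences and square equations\<close>

lemma prime_two_or_odd:
  fixes r :: nat
  assumes "prime r" obtains "r = 2" | "odd r"
  using assms primes_dvd_imp_eq[of 2 r] two_is_prime_nat by blast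

lemma odd_square_mod_8:
  fixes f :: int
  assumes "odd f" obtains m where "f\<^sup>2 = 8 * m + 1"
proof -
  obtain k where k: "f = 2 * k + 1" using assms by (rule oddE)
  have "even (k * (k + 1))" by simp
  then obtain m where "k * (k + 1) = 2 * m" by blast
  then have "f\<^sup>2 = 8 * m + 1" unfolding k by (simp add: power2_eq_square algebra_simps)
  then show ?thesis by (rule that)
qed

text \<open>Such an \<open>f\<close> would be odd with square 3 modulo 4.\<close>

lemma neq_uminus_square_mod_4:
  fixes f m :: int
  shows "1 - 4 * m \<noteq> - (f\<^sup>2)"
proof
  assume *: "1 - 4 * m = - (f\<^sup>2)"
  then have eq: "f\<^sup>2 = 4 * m - 1" by simp
  have "odd (f\<^sup>2)" unfolding eq by simp
  then have "odd f" by simp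
  then obtain k where "f\<^sup>2 = 8 * k + 1" by (rule odd_square_mod_8)
  then have "4 * m - 1 = 8 * k + 1" using eq by simp
  then show False by presburger
qed

text \<open>Such an \<open>f\<close> would be odd, so \<open>3 * f ^ 2\<close> would be 3 modulo 8,
  not 7.\<close>

lemma neq_uminus_three_square_mod_8:
  fixes f m :: int
  shows "1 - 8 * m \<noteq> - 3 * f\<^sup>2"
proof
  assume *: "1 - 8 * m = - 3 * f\<^sup>2"
  then have eq: "3 * f\<^sup>2 = 8 * m - 1" by simp
  have "odd (3 * f\<^sup>2)" unfolding eq by simp
  then have "odd f" by simp
  then obtain k where "f\<^sup>2 = 8 * k + 1" by (rule odd_square_mod_8)
  then have "3 * (8 * k + 1) = 8 * m - 1" using eq by simp
  then show False by presburger
qed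

lemma lucas_V_two: "lucas_V c q 2 = c\<^sup>2 - 2 * q"
  by (simp add: numeral_2_eq_2)

lemma int_square_diff_eq_1:
  fixes x y :: int
  assumes "x\<^sup>2 = y\<^sup>2 + 1"
  shows "y = 0"
proof -
  have "(\<bar>x\<bar> - \<bar>y\<bar>) * (\<bar>x\<bar> + \<bar>y\<bar>) = \<bar>x\<bar>\<^sup>2 - \<bar>y\<bar>\<^sup>2" by (simp add: power2_eq_square algebra_simps)
  also have "\<dots> = 1" using assms by simp
  finally have "\<bar>x\<bar> - \<bar>y\<bar> = 1 \<and> \<bar>x\<bar> + \<bar>y\<bar> = 1 \<or> \<bar>x\<bar> - \<bar>y\<bar> = -1 \<and> \<bar>x\<bar> + \<bar>y\<bar> = -1"
    by (rule zmult_eq_1_iff[THEN iffD1, elim_format]) auto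
  then show ?thesis by linarith
qed

lemma int_mult_eq_3_square:
  fixes a b g :: int
  assumes "coprime a b" "a * b = 3 * g\<^sup>2" "a > 0" "b > 0"
  shows "\<exists>x. a = x\<^sup>2 \<or> b = x\<^sup>2"
proof -
  have "int (nat a * nat b) = int (3 * (nat \<bar>g\<bar>)\<^sup>2)" using assms by simp
  then have "nat a * nat b = 3 * (nat \<bar>g\<bar>)\<^sup>2" by (simp only: of_nat_eq_iff)
  moreover have "coprime (nat a) (nat b)" using assms by (simp add: coprime_nat_abs_left_iff flip: coprime_int_iff)
  ultimately obtain x where "nat a = x\<^sup>2 \<or> nat b = x\<^sup>2" 
    using mult_eq_3_square[of "nat a" "nat b"] assms by (metis zero_less_nat_eq)
  then have "a = (int x)\<^sup>2 \<or> b = (int x)\<^sup>2" using assms by (metis int_nat_eq less_imp_le of_nat_power)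
  then show ?thesis by blast
qed

text \<open>With trace 1, odd \<open>r\<close> falls to \<open>abs_lucas_V_neq_1\<close>. For
  \<open>r = 2\<close>, \<open>c ^ 2\<close> is \<open>2 ^ (j + 1)\<close> plus or minus 1; minus
  fails modulo 4, and plus leaves only \<open>9 = 8 + 1\<close>, that is
  \<open>n = 4\<close>.\<close>

lemma splits_with_order_two:
  assumes "n > 0" "n \<noteq> 4"
  shows "splits_with_order (1 - 2 ^ (n + 2)) 2 n"
proof (rule ccontr)
  assume no: "\<not> splits_with_order (1 - 2 ^ (n + 2)) 2 n"
  have D: "(1 - 2 ^ (n + 2) :: int) = 1 - 4 * 2 ^ n" by simp
  obtain i where i: "n = Suc i" using assms by (cases n) auto
  have D8: "(1 - 2 ^ (n + 2) :: int) = 1 - 8 * 2 ^ i" by (simp add: i)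
  have "(1 - 2 ^ (n + 2) :: int) < 0" unfolding D8 using one_le_power[of "2::int" i] by linarith
  moreover have "(1::int)\<^sup>2 - 1\<^sup>2 * (1 - 2 ^ (n + 2)) = 4 * int 2 ^ n" by simp
  ultimately show False
  proof (rule not_splits_with_orderE[OF no _ two_is_prime_nat assms(1)])
    fix r j c assume r: "prime r" and n: "n = r * j" and V: "\<bar>lucas_V c (int 2 ^ j) r\<bar> = \<bar>1\<bar>"
    have j: "j > 0" using n assms by (cases j) auto
    show False using r
    proof (rule prime_two_or_odd)
      assume "odd r"
      moreover have "2 \<le> int 2 ^ j" using j self_le_power[of "2::int" j] by simp
      ultimately show False using abs_lucas_V_neq_1[OF r] V by simp
    next
      assume "r = 2"
      obtain k where k: "j = Suc k" using j by (cases j) auto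
      have V: "\<bar>c\<^sup>2 - 4 * 2 ^ k\<bar> = 1" using V by (simp add: \<open>r = 2\<close> lucas_V_two k)
      then have c: "c\<^sup>2 = 4 * 2 ^ k + 1 \<or> c\<^sup>2 = 4 * 2 ^ k - 1" by linarith
      moreover have "odd (4 * 2 ^ k + 1 :: int)" "odd (4 * 2 ^ k - 1 :: int)" by simp_all
      ultimately have "odd (c\<^sup>2)" by metis
      then have "odd c" by simp
      then obtain m where m: "c\<^sup>2 = 8 * m + 1" by (rule odd_square_mod_8)
      have "8 * m + 1 \<noteq> 4 * x - 1" for x by presburger
      then have c: "c\<^sup>2 = 4 * 2 ^ k + 1" using c m by metis
      define b where "b = \<bar>c\<bar> div 2"
      have cb: "\<bar>c\<bar> = 2 * b + 1" using \<open>odd c\<close> by (simp add: b_def)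
      have "\<bar>c\<bar>\<^sup>2 = 4 * 2 ^ k + 1" using c by simp
      then have bb: "b * (b + 1) = 2 ^ k" unfolding cb by (simp add: power2_eq_square algebra_simps)
      have b0: "0 \<le> b" by (simp add: b_def)
      \<comment> \<open>One of the consecutive numbers \<open>b\<close> and \<open>b + 1\<close> is
        odd, and an odd positive divisor of a power of 2 is 1.\<close>
      have "b = 1"
      proof -
        have "b \<noteq> 0" using bb by auto
        have odd1: "x = 1" if "x dvd 2 ^ k" "odd x" "x > 0" for x :: int
        proof -
          have "coprime x (2 ^ k)" using \<open>odd x\<close> by simp
          then have "is_unit x" by (rule coprime_common_divisor[OF _ dvd_refl \<open>x dvd 2 ^ k\<close>])
          then show ?thesis using \<open>x > 0\<close> by simp
        qed
        have dvd: "b dvd 2 ^ k" "b + 1 dvd 2 ^ k" unfolding bb[symmetric] by simp_all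
        show ?thesis
        proof (cases "odd b")
          case True
          then show ?thesis using odd1[OF dvd(1)] \<open>b \<noteq> 0\<close> b0 by simp
        next
          case False
          then have "b + 1 = 1" using odd1[OF dvd(2)] b0 by simp
          then show ?thesis using \<open>b \<noteq> 0\<close> by simp
        qed
      qed
      then have "(2::int) ^ k = 2 ^ 1" using bb by simp
      then have "k = 1" by (simp only: power_inject_exp)
      then show False using assms n k \<open>r = 2\<close> by simp
    qed
  next
    fix f :: int assume "1 - 2 ^ (n + 2) = - (f\<^sup>2)" then show False using neq_uminus_square_mod_4 D by metis
  next
    fix f :: int assume "1 - 2 ^ (n + 2) = - 3 * f\<^sup>2" then show False using neq_uminus_three_square_mod_8 D8 by metis
  qed simp
qed

text \<open>The norm equation is \<open>25 + 39 = 4 * 2 ^ 4\<close>, so the trace is 5. Only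
  \<open>r = 2\<close> divides 4, and neither 13 nor 3 is a square.\<close>

lemma splits_with_order_39: "splits_with_order (- 39) 2 4"
proof (rule ccontr)
  assume no: "\<not> splits_with_order (- 39) 2 4"
  have "(4::nat) > 0" by simp
  moreover have "(5::int)\<^sup>2 - 1\<^sup>2 * (- 39) = 4 * int 2 ^ 4" by simp
  moreover have "coprime (5::int) (int 2)" by simp
  ultimately show False
  proof (rule not_splits_with_orderE[OF no _ two_is_prime_nat, rotated])
    fix r j c assume r: "prime r" and n: "4 = r * j" and V: "\<bar>lucas_V c (int 2 ^ j) r\<bar> = \<bar>5\<bar>"
    have "r dvd 4" using n by (rule dvdI)
    then have "r dvd 2 ^ 2" by simp
    then have "r dvd 2" using r prime_dvd_power by blast
    then have "r = 2" using r primes_dvd_imp_eq two_is_prime_nat by blast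
    then have "j = 2" using n by simp
    then have "\<bar>c\<^sup>2 - 8\<bar> = 5" using V \<open>r = 2\<close> by (simp add: lucas_V_two)
    then have c: "c\<^sup>2 = 13 \<or> c\<^sup>2 = 3" by linarith
    moreover have "odd (13 :: int)" "odd (3 :: int)" by simp_all
    ultimately have "odd (c\<^sup>2)" by metis
    then have "odd c" by simp
    then obtain m where m: "c\<^sup>2 = 8 * m + 1" by (rule odd_square_mod_8)
    have "8 * m + 1 \<noteq> 13" "8 * m + 1 \<noteq> 3" by presburger+
    then show False using c m by metis
  next
    fix f :: int assume "- 39 = - (f\<^sup>2)" then show False using neq_uminus_square_mod_4[of 10 f] by simp
  next
    fix f :: int assume "- 39 = - 3 * f\<^sup>2" then show False using neq_uminus_three_square_mod_8[of 5 f] by simp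
  qed simp
qed

text \<open>Eliminating \<open>S\<close> gives \<open>(2 * b) ^ 2 = c ^ 2 - 1\<close> or
  \<open>(2 * b) ^ 2 = c ^ 2 + 3\<close>; squares so close together are tiny, against
  \<open>1 < S\<close>.\<close>

lemma no_common_square_solution:
  fixes S c b :: int
  assumes "1 < S" "c\<^sup>2 = 2 * S - 1" "2 * b\<^sup>2 = S + 1 \<or> 2 * b\<^sup>2 = S - 1"
  shows False
  using assms(3)
proof
  assume b: "2 * b\<^sup>2 = S - 1"
  then have "c\<^sup>2 = (2 * b)\<^sup>2 + 1" using assms by (simp add: power_mult_distrib)
  then have "2 * b = 0" by (rule int_square_diff_eq_1)
  then show False using b assms by simp
next
  assume b: "2 * b\<^sup>2 = S + 1"
  then have cb: "(2 * \<bar>b\<bar>)\<^sup>2 = \<bar>c\<bar>\<^sup>2 + 3" using assms by (simp add: power_mult_distrib)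
  have "\<bar>c\<bar>\<^sup>2 < (2 * \<bar>b\<bar>)\<^sup>2" unfolding cb by simp
  then have "\<bar>c\<bar> < 2 * \<bar>b\<bar>" by (rule power_less_imp_less_base) simp
  then have "(\<bar>c\<bar> + 1)\<^sup>2 \<le> (2 * \<bar>b\<bar>)\<^sup>2" by (intro power_mono) auto
  then have "\<bar>c\<bar> \<le> 1" unfolding cb by (simp add: power2_eq_square algebra_simps)
  then have "\<bar>c\<bar>\<^sup>2 \<le> 1\<^sup>2" by (intro power_mono) auto
  then show False using assms by simp
qed

lemma odd_prime_split_cases:
  fixes l n :: nat
  assumes l: "prime l" "odd l" and n: "n > 0"
  shows "splits_with_order (1 - int l ^ n) l n \<or> splits_with_order (1 - 4 * int l ^ n) l n"
proof (rule ccontr)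
  assume "\<not> ?thesis"
  then have no1: "\<not> splits_with_order (1 - int l ^ n) l n"
    and no2: "\<not> splits_with_order (1 - 4 * int l ^ n) l n" by auto
  define L where "L = int l"
  have l3: "l \<ge> 3" using l prime_ge_2_nat[of l] by (cases "l = 2") auto
  have L3: "3 \<le> L" and Lodd: "odd L" using l3 l by (simp_all add: L_def)
  have Lpow: "3 \<le> L ^ i" if "i > 0" for i
    using L3 self_le_power[of L i] that by linarith
  have D1neg: "1 - int l ^ n < 0" and D2neg: "1 - 4 * int l ^ n < 0" using Lpow[OF n] by (simp_all add: L_def)
  \<comment> \<open>The elements used are \<open>1 + w\<close> of trace 2 in the first field and
    \<open>(1 + w) / 2\<close> of trace 1 in the second.\<close>
  have eq1: "(2::int)\<^sup>2 - 2\<^sup>2 * (1 - int l ^ n) = 4 * int l ^ n" by simp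
  have eq2: "(1::int)\<^sup>2 - 1\<^sup>2 * (1 - 4 * int l ^ n) = 4 * int l ^ n" by simp
  have cop: "coprime (2::int) (int l)" using l by simp
  \<comment> \<open>If both fields were generated by the square root of -3, eliminating
    \<open>L ^ n\<close> would leave squares differing by 1.\<close>
  have nofg: False if f: "1 - 4 * L ^ n = - 3 * f\<^sup>2" and g: "1 - L ^ n = - 3 * g\<^sup>2" for f g
  proof -
    have "f\<^sup>2 = (2 * g)\<^sup>2 + 1" using f g by (simp add: power_mult_distrib)
    then have "2 * g = 0" by (rule int_square_diff_eq_1)
    then show False using g Lpow[OF n] by simp
  qed
  have case2: "(\<exists>c. 2 dvd n \<and> c\<^sup>2 = 2 * L ^ (n div 2) - 1) \<or> (3 dvd n \<and> (\<exists>f. 1 - 4 * L ^ n = - 3 * f\<^sup>2))"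
    using no2 D2neg l(1) n eq2 coprime_1_left
  proof (rule not_splits_with_orderE)
    fix r j c assume r: "prime r" and nrj: "n = r * j" and V: "\<bar>lucas_V c (int l ^ j) r\<bar> = \<bar>1\<bar>"
    have j: "j > 0" using nrj n by (cases j) auto
    show ?thesis using r
    proof (rule prime_two_or_odd)
      assume "odd r"
      then show ?thesis using abs_lucas_V_neq_1[OF r, of "int l ^ j" c] V Lpow[OF j] by (simp add: L_def)
    next
      assume "r = 2"
      then have nj: "n = 2 * j" using nrj by simp
      have "\<bar>c\<^sup>2 - 2 * L ^ j\<bar> = 1" using V \<open>r = 2\<close> by (simp add: lucas_V_two L_def)
      then have c: "c\<^sup>2 = 2 * L ^ j + 1 \<or> c\<^sup>2 = 2 * L ^ j - 1" by linarith
      have "odd (2 * L ^ j + 1)" "odd (2 * L ^ j - 1)" by simp_all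
      then have "odd (c\<^sup>2)" using c by metis
      then have "odd c" by simp
      then obtain m where m: "c\<^sup>2 = 8 * m + 1" by (rule odd_square_mod_8)
      have "odd (L ^ j)" using Lodd by simp
      then obtain x where x: "L ^ j = 2 * x + 1" by (rule oddE)
      \<comment> \<open>\<open>2 * L ^ j + 1\<close> is 3 modulo 4 and so no odd square.\<close>
      have "8 * m + 1 \<noteq> 2 * (2 * x + 1) + 1" by presburger
      then have "c\<^sup>2 = 2 * L ^ j - 1" using c m x by metis
      then show ?thesis using nj by auto
    qed
  next
    fix f assume "1 - 4 * int l ^ n = - (f\<^sup>2)" then show ?thesis using neq_uminus_square_mod_4 by metis
  next
    fix f assume "3 dvd n" "1 - 4 * int l ^ n = - 3 * f\<^sup>2" then show ?thesis unfolding L_def by blast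
  qed
  show False
  proof (cases "even n")
    case True
    then obtain h where h: "n = 2 * h" by blast
    define S where "S = L ^ h"
    have Sn: "L ^ n = S\<^sup>2" by (simp add: S_def h power_mult mult.commute flip: power_mult)
    have S: "3 \<le> S" "odd S" using Lpow[of h] h n Lodd by (simp_all add: S_def)
    \<comment> \<open>In the Eisenstein case one of the coprime factors \<open>2 * S - 1\<close> and
      \<open>2 * S + 1\<close> is a square, and the second is 3 modulo 4.\<close>
    have "\<exists>c. c\<^sup>2 = 2 * S - 1"
      using case2
    proof (elim disjE exE conjE)
      fix f assume "1 - 4 * L ^ n = - 3 * f\<^sup>2"
      then have "(2 * S - 1) * (2 * S + 1) = 3 * f\<^sup>2" by (simp add: Sn power2_eq_square algebra_simps)
      moreover have "coprime (2 * S - 1) (2 * S + 1)"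
      proof (rule coprimeI)
        fix c assume c: "c dvd 2 * S - 1" "c dvd 2 * S + 1"
        have "c dvd (2 * S + 1) - (2 * S - 1)" by (rule dvd_diff[OF c(2,1)])
        then have "c dvd 2" by simp
        moreover have "coprime (2 * S - 1) 2" by simp
        ultimately show "is_unit c" using c(1) by (intro coprime_common_divisor)
      qed
      ultimately obtain x where x: "2 * S - 1 = x\<^sup>2 \<or> 2 * S + 1 = x\<^sup>2"
        using int_mult_eq_3_square[of "2 * S - 1" "2 * S + 1" f] S by auto
      have "odd (x\<^sup>2)" using x
      proof
        assume eq: "2 * S - 1 = x\<^sup>2"
        show ?thesis unfolding eq[symmetric] by simp
      next
        assume eq: "2 * S + 1 = x\<^sup>2"
        show ?thesis unfolding eq[symmetric] by simp
      qed
      then have "odd x" by simp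
      then obtain m where m: "x\<^sup>2 = 8 * m + 1" by (rule odd_square_mod_8)
      obtain y where y: "S = 2 * y + 1" using S(2) by (rule oddE)
      have "2 * (2 * y + 1) + 1 \<noteq> 8 * m + 1" by presburger
      then show ?thesis using x m y by metis
    qed (auto simp: S_def h)
    then obtain c where c: "c\<^sup>2 = 2 * S - 1" by blast
    \<comment> \<open>The first field contributes this equation in two ways: \<open>r = 2\<close>
      gives \<open>c = 2 * b\<close>, and the Eisenstein case gives
      \<open>y * (y + 1) = 3 * g ^ 2\<close> with \<open>S = 2 * y + 1\<close>.\<close>
    have "\<exists>b. 2 * b\<^sup>2 = S + 1 \<or> 2 * b\<^sup>2 = S - 1"
      using no1 D1neg l(1) n eq1 cop
    proof (rule not_splits_with_orderE)
      fix r j c assume r: "prime r" and nrj: "n = r * j" and V: "\<bar>lucas_V c (int l ^ j) r\<bar> = \<bar>2\<bar>"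
      have j: "j > 0" using nrj n by (cases j) auto
      show ?thesis using r
      proof (rule prime_two_or_odd)
        assume "r = 2"
        then have "j = h" using nrj h by simp
        then have "\<bar>c\<^sup>2 - 2 * S\<bar> = 2" using V \<open>r = 2\<close> by (simp add: lucas_V_two L_def S_def)
        then have "c\<^sup>2 = 2 * S + 2 \<or> c\<^sup>2 = 2 * S - 2" by (simp add: abs_if split: if_splits)
        then have cS: "c\<^sup>2 = 2 * (S + 1) \<or> c\<^sup>2 = 2 * (S - 1)" by (simp add: algebra_simps)
        then have "even (c\<^sup>2)" by (metis dvd_triv_left)
        then have "even c" by simp
        then obtain b where "c = 2 * b" by blast
        then have "2 * b\<^sup>2 = S + 1 \<or> 2 * b\<^sup>2 = S - 1" using cS by (auto simp: power_mult_distrib)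
        then show ?thesis by blast
      next
        assume ro: "odd r"
        \<comment> \<open>Now \<open>l ^ j\<close> is an odd square, so \<open>s = 2\<close> meets
          the condition of \<open>abs_lucas_V_neq_2\<close>.\<close>
        have "even j" using ro nrj True by simp
        then obtain i where i: "j = 2 * i" by blast
        have "odd (L ^ i)" using Lodd by simp
        then obtain m where "(L ^ i)\<^sup>2 = 8 * m + 1" by (rule odd_square_mod_8)
        then have "int l ^ j - 1 = 2\<^sup>2 * (2 * m)" by (simp add: i L_def mult.commute flip: power_mult)
        then have "2\<^sup>2 dvd int l ^ j - 1" by (rule dvdI)
        moreover have "prime (2::int)" by simp
        ultimately have *: "r = 3 \<or> (\<exists>s. prime s \<and> s\<^sup>2 dvd int l ^ j - 1)" by blast
        have "1 < int l ^ j" "odd (int l ^ j)" using Lpow[OF j] l by (simp_all add: L_def)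
        then have "\<bar>lucas_V c (int l ^ j) r\<bar> \<noteq> 2" using abs_lucas_V_neq_2 r ro * by blast
        then show ?thesis using V by simp
      qed
    next
      fix f assume "1 - int l ^ n = - (f\<^sup>2)"
      then have "S\<^sup>2 = f\<^sup>2 + 1" using Sn by (simp add: L_def)
      then have "f = 0" by (rule int_square_diff_eq_1)
      then have "S * S = 1" using \<open>S\<^sup>2 = f\<^sup>2 + 1\<close> by (simp add: power2_eq_square)
      then show ?thesis using S by (simp add: zmult_eq_1_iff)
    next
      fix f assume "1 - int l ^ n = - 3 * f\<^sup>2"
      then have SS: "S\<^sup>2 = 3 * f\<^sup>2 + 1" using Sn by (simp add: L_def)
      obtain y where y: "S = 2 * y + 1" using S(2) by (rule oddE)
      have "4 * (y * (y + 1)) = 3 * f\<^sup>2" using SS by (simp add: y power2_eq_square algebra_simps)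
      moreover from this have "even (3 * f\<^sup>2)" by (metis even_mult_iff even_numeral)
      then have "even f" by simp
      then obtain g where "f = 2 * g" by blast
      ultimately have "y * (y + 1) = 3 * g\<^sup>2" by (simp add: power_mult_distrib)
      then obtain x where "y = x\<^sup>2 \<or> y + 1 = x\<^sup>2"
        using int_mult_eq_3_square[of y "y + 1" g] S y by auto
      then have "2 * x\<^sup>2 = S - 1 \<or> 2 * x\<^sup>2 = S + 1" by (auto simp: y)
      then show ?thesis by blast
    qed
    then show False using no_common_square_solution[OF _ c] S by auto
  next
    case False
    then obtain f where f: "3 dvd n" "1 - 4 * L ^ n = - 3 * f\<^sup>2" using case2 by auto
    have Ln: "4 * L ^ n = 3 * f\<^sup>2 + 1" using f by simp
    have "x mod 3 = 4 * x mod 3" for x :: int by presburger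
    then have "L ^ n mod 3 = (3 * f\<^sup>2 + 1) mod 3" using Ln by metis
    then have Ln1: "L ^ n mod 3 = 1" by simp
    \<comment> \<open>From \<open>L ^ n\<close> being 1 modulo 3 with \<open>n\<close> odd.\<close>
    have "L mod 3 = 1"
    proof -
      have "L mod 3 = 0 \<or> L mod 3 = 1 \<or> L mod 3 = 2" by presburger
      then show ?thesis
      proof (elim disjE)
        assume "L mod 3 = 0"
        then have "3 dvd L" by (rule mod_0_imp_dvd)
        moreover have "L dvd L ^ n" using n by (intro dvd_power) simp
        ultimately have "3 dvd L ^ n" by (rule dvd_trans)
        then show ?thesis using Ln1 by (simp add: dvd_eq_mod_eq_0)
      next
        assume L2: "L mod 3 = 2"
        then have "[L = -1] (mod 3)" by (simp add: cong_def)
        then have "[L ^ n = (-1) ^ n] (mod 3)" by (rule cong_pow)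
        then have "[L ^ n = -1] (mod 3)" using False by simp
        then show ?thesis using Ln1 by (simp add: cong_def)
      qed
    qed
    then have L1: "[L = 1] (mod 3)" by (simp add: cong_def)
    show False
      using no1 D1neg l(1) n eq1 cop
    proof (rule not_splits_with_orderE)
      fix r j c assume r: "prime r" and nrj: "n = r * j" and V: "\<bar>lucas_V c (int l ^ j) r\<bar> = \<bar>2\<bar>"
      have j: "j > 0" using nrj n by (cases j) auto
      have ro: "odd r" using nrj False by simp
      \<comment> \<open>If \<open>r\<close> is not 3, then 3 divides \<open>j\<close>, and the cube
        of a number that is 1 modulo 3 is 1 modulo 9; so \<open>s = 3\<close> serves.\<close>
      have "r = 3 \<or> 3\<^sup>2 dvd int l ^ j - 1"
      proof (cases "r = 3")
        case r3: False
        then have "\<not> 3 dvd r" using primes_dvd_imp_eq[of 3 r] r by auto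
        then have "3 dvd j" using f(1) nrj prime_dvd_mult_iff[of "3::nat" r j] by simp
        then obtain i where i: "j = 3 * i" by blast
        have "[L ^ i = 1 ^ i] (mod 3)" using L1 by (rule cong_pow)
        then have "3 dvd L ^ i - 1" by (simp add: cong_iff_dvd_diff)
        then obtain m where "L ^ i - 1 = 3 * m" by blast
        then have m: "L ^ i = 3 * m + 1" by simp
        have "L ^ j = (L ^ i) ^ 3" by (simp add: i mult.commute flip: power_mult)
        then have "L ^ j - 1 = 3\<^sup>2 * (3 * m ^ 3 + 3 * m\<^sup>2 + m)"
          unfolding m by (simp add: power2_eq_square power3_eq_cube algebra_simps)
        then have "3\<^sup>2 dvd L ^ j - 1" by (rule dvdI)
        then show ?thesis by (simp add: L_def)
      qed simp
      moreover have "prime (3::int)" by simp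
      ultimately have *: "r = 3 \<or> (\<exists>s. prime s \<and> s\<^sup>2 dvd int l ^ j - 1)" by blast
      have "1 < int l ^ j" "odd (int l ^ j)" using Lpow[OF j] l by (simp_all add: L_def)
      then have "\<bar>lucas_V c (int l ^ j) r\<bar> \<noteq> 2" using abs_lucas_V_neq_2 r ro * by blast
      then show False using V by simp
    next
      fix g assume "1 - int l ^ n = - 3 * g\<^sup>2"
      then have "1 - L ^ n = - 3 * g\<^sup>2" by (simp add: L_def)
      then show False by (rule nofg[OF f(2)])
    qed (use False in simp)
  qed
qed

theorem theorem1p3:
  shows "(\<forall>n::nat. n > 0 \<and> n \<noteq> 4 \<longrightarrow> splits_with_order (1 - 2 ^ (n + 2)) 2 n)
    \<and> splits_with_order (-39) 2 4
    \<and> (\<forall>(l::nat) (n::nat). prime l \<and> odd l \<and> n > 0 \<longrightarrow>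
         splits_with_order (1 - int l ^ n) l n \<or> splits_with_order (1 - 4 * int l ^ n) l n)"
  using splits_with_order_two splits_with_order_39 odd_prime_split_cases by blast

end
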